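(* There are infinitely many primes that are $d$-translated unit sensitive for every nonnegative integer $d$ (i.e. $[0,\infty)$-translated unit sensitive) and are also Brier numbers. In fact, let $A$ be the 139-digit integer $$A=1058826054327683637421373901700849013662528837237037593649866983219952824339882555233842344362162520787653763315998320477054896263434901090$$ and let $B$ be the 138-digit integer $$B=292134647723778159914962540207823140335126344033210264225285566059959956372273970360496308095920463669048323126517085888353814417281244783.$$ Then there are infinitely many primes of the form $Am+B$, with $m$ a nonnegative integer, that are both $[0,\infty)$-translated unit sensitive and Brier numbers.
   Context: All digits are base 10. For a nonnegative integer $d$, a positive integer $n$ is called $d$-translated unit sensitive if appending $d$ zeros to the right of $n$ and then changing the unit digit to any possible unit digit $0,1,\dots,9$ results in a composite number, so long as the resulting number is not $n$ itself. Explicitly: for $d\ge 1$, this means $10^d n+j$ is composite for every $j\in\{0,1,\dots,9\}$; for $d=0$ (in which case $n$ is also called unit sensitive), it means $10\lfloor n/10\rfloor+j$ is composite for every $j\in\{0,1,\dots,9\}$ with $10\lfloor n/10\rfloor+j\ne n$. The integer $n$ is called $[0,\infty)$-translated unit sensitive if it is $d$-translated unit sensitive for every nonnegative integer $d$. A Sierpiński number is a positive odd integer $k$ such that $k\cdot 2^n+1$ is composite for all nonnegative integers $n$. A Riesel number is a positive odd integer $k$ such that $k\cdot 2^n-1$ is composite for all nonnegative integers $n$. A Brier number is an integer that is both a Sierpiński number and a Riesel number. *)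

theory Defs
  imports Main "HOL-Computational_Algebra.Primes"
begin

definition composite :: "nat \<Rightarrow> bool" where
  "composite n \<longleftrightarrow> 1 < n \<and> \<not> prime n"

definition translated_unit_sensitive :: "nat \<Rightarrow> nat \<Rightarrow> bool" where
  "translated_unit_sensitive d n \<longleftrightarrow> 0 < n \<and>
     (if d = 0
      then \<forall>j\<in>{0..9}. 10 * (n div 10) + j \<noteq> n \<longrightarrow> composite (10 * (n div 10) + j)
      else \<forall>j\<in>{0..9}. composite (10 ^ d * n + j))"

definition all_translated_unit_sensitive :: "nat \<Rightarrow> bool" where
  "all_translated_unit_sensitive n \<longleftrightarrow> (\<forall>d. translated_unit_sensitive d n)"

definition sierpinski_number :: "nat \<Rightarrow> bool" where
  "sierpinski_number k \<longleftrightarrow> 0 < k \<and> odd k \<and> (\<forall>n. composite (k * 2 ^ n + 1))"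

(* Subtraction on nat does not truncate here, since k * 2 ^ n is positive. *)
definition riesel_number :: "nat \<Rightarrow> bool" where
  "riesel_number k \<longleftrightarrow> 0 < k \<and> odd k \<and> (\<forall>n. composite (k * 2 ^ n - 1))"

definition brier_number :: "nat \<Rightarrow> bool" where
  "brier_number k \<longleftrightarrow> sierpinski_number k \<and> riesel_number k"

definition A_const :: nat where
  "A_const = 1058826054327683637421373901700849013662528837237037593649866983219952824339882555233842344362162520787653763315998320477054896263434901090"

definition B_const :: nat where
  "B_const = 292134647723778159914962540207823140335126344033210264225285566059959956372273970360496308095920463669048323126517085888353814417281244783"

end

theory Submission
  imports Defs "HOL-Algebra.Elementary_Groups" "HOL-Analysis.Analysis"
    "HOL-Number_Theory.Number_Theory" "HOL-Real_Asymp.Real_Asymp"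
begin

text \<open>The prime divisors of $A$ make up covering systems of congruences for the exponent: the residue of
  $B$ modulo each of them is such that every number that has to be composite is divisible by one of
  these primes. Hence every prime $p \<equiv> B$ modulo $A$ has the required properties, and there are
  infinitely many of them by Dirichlet's theorem, since $A$ and $B$ are coprime.

  Dirichlet's theorem is proved with $L$-functions of a real argument $s > 1$. As $s \<rightarrow> 1$, the series
  $\<Sum> \<psi>(n) \<Lambda>(n) n^{-s}$ stays bounded for a nonprincipal character because $L(1, \<psi>) \<noteq> 0$, and it tends
  to infinity for the principal one, so by orthogonality it is unbounded on every coprime residue class.\<close>

section \<open>Characters of finite abelian groups\<close>

text \<open>The covering primes divide numbers 2^k - 1 or 10^k - 1 with small k, so that the powers
  of 2 or of 10 modulo such a prime have a short period. \<open>B_const\<close> solves all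
  congruences that the coverings demand. A prime can serve several coverings only if they ask for
  the same residue: 3 serves both coverings for powers of 2 and the digits 1 and 7, 7 and 11 each
  serve the Riesel covering and one digit, and 5 serves the Sierpinski covering and, together with
  2, fixes the last digit 3. On the analytic side, staying on the real axis means doing without
  complex logarithms and without orders of zeros of analytic functions. The convolution identity
  behind -L'/L replaces the former, and a one-sided Lipschitz bound at 1 the latter. The obstacle is
  non-vanishing at 1: a zero for a nonreal character brings a second one for its conjugate, which is
  one zero too many, but a real character is its own conjugate and needs a separate
  argument.\<close>

lemma complex_root_exists:
  assumes "n > 0"
  shows "\<exists>z. z ^ n = (c :: complex)"
proof -
  have "rcis (root n (cmod c)) (Arg c / n) ^ n = c"
    using assms by (simp add: DeMoivre2 rcis_cmod_Arg)
  thus ?thesis by blast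
qed

text \<open>The domain \<open>H\<close> is kept apart from \<open>G\<close> because characters are
  extended from subgroup to larger subgroup. Nonzero values suffice to force the value 1 at the
  unit.\<close>

definition mult_character :: "('a, 'b) monoid_scheme \<Rightarrow> 'a set \<Rightarrow> ('a \<Rightarrow> complex) \<Rightarrow> bool" where
  "mult_character G H \<psi> \<longleftrightarrow> (\<forall>x\<in>H. \<forall>y\<in>H. \<psi> (x \<otimes>\<^bsub>G\<^esub> y) = \<psi> x * \<psi> y) \<and> (\<forall>x\<in>H. \<psi> x \<noteq> 0)"

lemma (in group) mult_character_int_pow:
  assumes H: "subgroup H G" and \<psi>: "mult_character G H \<psi>" and x: "x \<in> H"
  shows "\<psi> (x [^] (k::int)) = \<psi> x powi k"
proof -
  have xG: "x \<in> carrier G" using H x by (meson subgroup.mem_carrier)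
  have xk: "x [^] (k::int) \<in> H" for k using H x by (simp add: subgroup_int_pow_closed)
  have mul: "\<psi> (u \<otimes> v) = \<psi> u * \<psi> v" and nz: "\<psi> u \<noteq> 0" if "u \<in> H" "v \<in> H" for u v
    using \<psi> that by (auto simp: mult_character_def)
  have one: "\<psi> \<one> = 1"
    using mul[of \<one> \<one>] nz[of \<one> \<one>] subgroup.one_closed[OF H] by simp
  have nat: "\<psi> (x [^] int n) = \<psi> x ^ n" for n
  proof (induction n)
    case (Suc n)
    have "x [^] int (Suc n) = x [^] int n \<otimes> x"
      using xG by (metis int_pow_int nat_pow_Suc)
    thus ?case using mul[OF xk x, of "int n"] Suc by simp
  qed (use one in simp)
  show ?thesis
  proof (cases "k \<ge> 0")
    case True
    thus ?thesis using nat[of "nat k"] by (simp add: power_int_def)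
  next
    case False
    have "x [^] k \<otimes> x [^] (-k) = \<one>"
      using xG by (simp flip: int_pow_mult)
    hence "\<psi> (x [^] k) * \<psi> (x [^] (-k)) = 1"
      using mul[OF xk xk, of k "-k"] one by simp
    moreover have "\<psi> (x [^] (-k)) = \<psi> x ^ nat (-k)"
      using nat[of "nat (-k)"] False by simp
    ultimately have "\<psi> (x [^] k) = inverse (\<psi> x ^ nat (-k))"
      by (metis inverse_unique mult.commute)
    thus ?thesis
      using False by (simp add: power_int_def power_inverse)
  qed
qed

text \<open>On the subgroup generated by \<open>H\<close> and \<open>a\<close>, only the
  well-definedness of h a^k |-> \<psi>(h) z^k is at stake. The powers of \<open>a\<close> inside
  \<open>H\<close> have exponents divisible by \<open>m\<close>, and there the choice of
  \<open>z\<close> agrees with \<psi>. Any such root \<open>z\<close> will do, which leaves room for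
  a nontrivial value.\<close>

lemma (in comm_group) mult_character_extend:
  assumes H: "subgroup H G" and \<psi>: "mult_character G H \<psi>"
    and a: "a \<in> carrier G" and m: "m > 0" "a [^] int m \<in> H"
    and least: "\<And>k. 0 < k \<Longrightarrow> a [^] int k \<in> H \<Longrightarrow> m \<le> k"
    and z: "z ^ m = \<psi> (a [^] int m)"
  shows "\<exists>K \<psi>'. subgroup K G \<and> H \<subseteq> K \<and> a \<in> K \<and> mult_character G K \<psi>' \<and> \<psi>' a = z \<and> (\<forall>x\<in>H. \<psi>' x = \<psi> x)"
proof -
  have HG: "x \<in> carrier G" if "x \<in> H" for x using H that by (meson subgroup.mem_carrier)
  have mul: "\<psi> (u \<otimes> v) = \<psi> u * \<psi> v" and nz: "\<psi> u \<noteq> 0" if "u \<in> H" "v \<in> H" for u v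
    using \<psi> that by (auto simp: mult_character_def)
  have oneH: "\<one> \<in> H" using subgroup.one_closed[OF H] .
  have one: "\<psi> \<one> = 1"
    using mul[of \<one> \<one>] nz[of \<one> \<one>] oneH by simp
  have z0: "z \<noteq> 0"
    using z nz[OF m(2) m(2)] m(1) by (metis power_0_left less_numeral_extra(3))
  have pow: "a [^] j \<in> H \<Longrightarrow> \<psi> (a [^] j) = z powi j" for j :: int
  proof -
    assume j: "a [^] j \<in> H"
    \<comment> \<open>Division with remainder: a nonzero remainder would be a positive exponent
      below \<open>m\<close> whose power lies in \<open>H\<close>.\<close>
    define q where "q = j div int m"
    define r where "r = nat (j mod int m)"
    have jr: "j = int m * q + int r" and r: "r < m"
      using m(1) by (auto simp: q_def r_def nat_less_iff)
    have mq: "a [^] (int m * q) \<in> H"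
      using subgroup_int_pow_closed[OF H m(2), of q] a by (simp add: int_pow_pow)
    have "a [^] int r = inv (a [^] (int m * q)) \<otimes> a [^] j"
      using a by (simp add: jr flip: int_pow_neg int_pow_mult)
    hence "a [^] int r \<in> H"
      using mq j H by (simp add: subgroup.m_closed subgroup.m_inv_closed)
    hence "r = 0" using least[of r] r by (cases "r = 0") auto
    hence "a [^] j = (a [^] int m) [^] q" using jr a by (simp add: int_pow_pow)
    hence "\<psi> (a [^] j) = (z ^ m) powi q"
      using mult_character_int_pow[OF H \<psi> m(2)] z by simp
    thus "\<psi> (a [^] j) = z powi j"
      using jr \<open>r = 0\<close> by (simp add: power_int_mult)
  qed
  define K where "K = H <#> range (\<lambda>k::int. a [^] k)"
  have K: "x \<in> K \<longleftrightarrow> (\<exists>h\<in>H. \<exists>k::int. x = h \<otimes> a [^] k)" for x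
    by (auto simp: K_def set_mult_def)
  have subK: "subgroup K G"
    unfolding K_def by (rule mult_subgroups[OF H subgroup_of_powers[OF a]])
  have wd: "\<psi> h * z powi k = \<psi> h' * z powi k'"
    if hh: "h \<in> H" "h' \<in> H" and e: "h \<otimes> a [^] k = h' \<otimes> a [^] k'" for h h' and k k' :: int
  proof -
    have "h = h' \<otimes> a [^] (k' - k)"
      using e hh[THEN HG] a by (simp add: int_pow_diff flip: m_assoc) (metis inv_solve_right int_pow_closed m_closed)
    moreover have "a [^] (k' - k) = inv h' \<otimes> h"
      using calculation hh[THEN HG] a by (metis inv_solve_left int_pow_closed)
    hence "a [^] (k' - k) \<in> H"
      using hh H by (simp add: subgroup.m_closed subgroup.m_inv_closed)
    ultimately have "\<psi> h = \<psi> h' * z powi (k' - k)"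
      using mul[OF hh(2)] pow by metis
    thus ?thesis using z0 by (simp add: power_int_diff field_simps)
  qed
  define \<psi>' where "\<psi>' = (\<lambda>x. THE c. \<exists>h\<in>H. \<exists>k::int. x = h \<otimes> a [^] k \<and> c = \<psi> h * z powi k)"
  have \<psi>': "\<psi>' (h \<otimes> a [^] k) = \<psi> h * z powi k" if "h \<in> H" for h and k :: int
    unfolding \<psi>'_def
  proof (rule the_equality)
    show "\<exists>h'\<in>H. \<exists>k'::int. h \<otimes> a [^] k = h' \<otimes> a [^] k' \<and> \<psi> h * z powi k = \<psi> h' * z powi k'"
      using that by blast
  next
    fix c assume "\<exists>h'\<in>H. \<exists>k'::int. h \<otimes> a [^] k = h' \<otimes> a [^] k' \<and> c = \<psi> h' * z powi k'"
    then obtain h' k' where "h' \<in> H" "h \<otimes> a [^] k = h' \<otimes> a [^] (k'::int)" "c = \<psi> h' * z powi k'"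
      by blast
    thus "c = \<psi> h * z powi k" using wd[OF that] by metis
  qed
  have ext: "\<psi>' h = \<psi> h" if "h \<in> H" for h
    using \<psi>'[OF that, of 0] that HG by simp
  have aa: "\<psi>' a = z" using \<psi>'[OF oneH, of 1] a one by (simp add: int_pow_1)
  have "mult_character G K \<psi>'"
    unfolding mult_character_def
  proof (intro conjI ballI)
    fix x y assume "x \<in> K" "y \<in> K"
    then obtain h k h' k' where xy: "h \<in> H" "x = h \<otimes> a [^] (k::int)" "h' \<in> H" "y = h' \<otimes> a [^] (k'::int)"
      unfolding K by blast
    have "x \<otimes> y = (h \<otimes> h') \<otimes> a [^] (k + k')"
      using xy HG a by (simp add: int_pow_mult m_ac)
    thus "\<psi>' (x \<otimes> y) = \<psi>' x * \<psi>' y"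
      using xy \<psi>' mul z0 H by (simp add: subgroup.m_closed power_int_add)
  next
    fix x assume "x \<in> K"
    thus "\<psi>' x \<noteq> 0" unfolding K using \<psi>' nz z0 by auto
  qed
  moreover have "H \<subseteq> K"
  proof
    fix h assume "h \<in> H"
    thus "h \<in> K" unfolding K using HG by (intro bexI[of _ h] exI[of _ 0]) auto
  qed
  moreover have "a \<in> K" unfolding K using a oneH by (intro bexI[of _ \<one>] exI[of _ 1]) (auto simp: int_pow_1)
  ultimately show ?thesis using subK aa ext by blast
qed

text \<open>A largest subgroup that contains \<open>a\<close> and carries a character nontrivial at
  \<open>a\<close> must be the whole group, since any element outside it could be adjoined.\<close>

lemma (in comm_group) mult_character_separates:
  assumes fin: "finite (carrier G)" and a: "a \<in> carrier G" "a \<noteq> \<one>"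
  shows "\<exists>\<psi>. mult_character G (carrier G) \<psi> \<and> \<psi> a \<noteq> 1"
proof -
  define P where "P = (\<lambda>H. subgroup H G \<and> a \<in> H \<and> (\<exists>\<psi>. mult_character G H \<psi> \<and> \<psi> a \<noteq> 1))"
  have order: "\<exists>k>0. b [^] int k \<in> H" if "subgroup H G" "b \<in> carrier G" for H b
  proof -
    have "b [^] int (Coset.order G) = \<one>" using that fin by (simp add: int_pow_int pow_order_eq_1)
    moreover have "Coset.order G > 0" using fin by (simp add: order_gt_0_iff_finite)
    ultimately show ?thesis using subgroup.one_closed[OF that(1)] by metis
  qed
  have ext: "\<exists>m>0. b [^] int m \<in> H \<and> (\<forall>k>0. b [^] int k \<in> H \<longrightarrow> m \<le> k)"
    if "subgroup H G" "b \<in> carrier G" for H b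
    using exists_least_iff[of "\<lambda>k. 0 < k \<and> b [^] int k \<in> H"] order[OF that]
    by (meson not_le_imp_less)
  have "\<exists>H. P H"
  proof -
    \<comment> \<open>Over the trivial subgroup the least exponent \<open>m\<close> is the order of
      \<open>a\<close>, so a primitive \<open>m\<close>-th root of unity is an admissible value at
      \<open>a\<close>.\<close>
    obtain m where m: "m > 0" "a [^] int m \<in> {\<one>}" "\<And>k. k > 0 \<Longrightarrow> a [^] int k \<in> {\<one>} \<Longrightarrow> m \<le> k"
      using ext[OF triv_subgroup a(1)] by metis
    have "m \<noteq> 1" using m(2) a by (auto simp: int_pow_1)
    hence m2: "m \<ge> 2" using m(1) by simp
    define z where "z = cis (2 * pi / m)"
    have "real m * (2 * pi / real m) = 2 * pi" using m(1) by simp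
    hence zm: "z ^ m = 1" by (simp only: z_def Complex.DeMoivre cis_2pi)
    have "z \<noteq> 1"
    proof
      assume "z = 1"
      hence "cos (2 * pi / m) = 1" by (simp add: z_def complex_eq_iff)
      then obtain i :: int where i: "2 * pi / real m = real_of_int i * 2 * pi" 
        unfolding cos_one_2pi_int by blast
      hence "1 = real_of_int (i * int m)" using m(1) by (simp add: field_simps)
      hence "i * int m = 1" by linarith
      hence "int m dvd 1" by (metis dvd_triv_right)
      thus False using m2 by simp
    qed
    moreover have "mult_character G {\<one>} (\<lambda>_. 1)" by (simp add: mult_character_def)
    ultimately show ?thesis
      using mult_character_extend[OF triv_subgroup _ a(1) m, of "\<lambda>_. 1" z] zm unfolding P_def by metis
  qed
  moreover have bound: "card H < Suc (card (carrier G))" if "P H" for H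
    using that fin by (auto simp: P_def less_Suc_eq_le intro!: card_mono subgroup.subset)
  ultimately obtain H where H: "P H" and max: "\<And>K. P K \<Longrightarrow> card K \<le> card H"
    using ex_has_greatest_nat[of P _ card "Suc (card (carrier G))"] by blast
  then obtain \<psi> where \<psi>: "subgroup H G" "a \<in> H" "mult_character G H \<psi>" "\<psi> a \<noteq> 1"
    by (auto simp: P_def)
  have "carrier G \<subseteq> H"
  proof
    fix b assume b: "b \<in> carrier G"
    obtain m where m: "m > 0" "b [^] int m \<in> H" "\<And>k. k > 0 \<Longrightarrow> b [^] int k \<in> H \<Longrightarrow> m \<le> k"
      using ext[OF \<psi>(1) b] by metis
    obtain z where z: "z ^ m = \<psi> (b [^] int m)" using complex_root_exists[OF m(1)] by blast
    obtain K \<psi>' where K: "subgroup K G" "H \<subseteq> K" "b \<in> K" "mult_character G K \<psi>'" "\<forall>x\<in>H. \<psi>' x = \<psi> x"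
      using mult_character_extend[OF \<psi>(1,3) b m z] by blast
    hence "P K" using \<psi> unfolding P_def by (metis subsetD)
    hence "card K \<le> card H" by (rule max)
    moreover have "finite K" using K(1) fin by (meson finite_subset subgroup.subset)
    ultimately have "K = H" using K(2) by (metis card_seteq)
    thus "b \<in> H" using K(3) by simp
  qed
  hence "H = carrier G" using \<psi>(1) subgroup.subset by blast
  thus ?thesis using \<psi> by blast
qed

section \<open>Dirichlet characters\<close>

definition dirichlet_char :: "nat \<Rightarrow> (nat \<Rightarrow> complex) \<Rightarrow> bool" where
  "dirichlet_char N \<psi> \<longleftrightarrow> (\<forall>m n. \<psi> (m * n) = \<psi> m * \<psi> n) \<and> (\<forall>n. \<psi> (n mod N) = \<psi> n) \<and>
     (\<forall>n. \<psi> n \<noteq> 0 \<longleftrightarrow> coprime n N)"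

definition principal_char :: "nat \<Rightarrow> nat \<Rightarrow> complex" where
  "principal_char N n = (if coprime n N then 1 else 0)"

lemma dirichlet_charD:
  assumes "dirichlet_char N \<psi>"
  shows "\<psi> (m * n) = \<psi> m * \<psi> n" "\<psi> (n mod N) = \<psi> n" "\<psi> n = 0 \<longleftrightarrow> \<not> coprime n N"
  using assms unfolding dirichlet_char_def by blast+

lemma dirichlet_char_cong:
  assumes "dirichlet_char N \<psi>" "[m = n] (mod N)"
  shows "\<psi> m = \<psi> n"
  using dirichlet_charD(2)[OF assms(1)] assms(2) unfolding cong_def by metis

lemma dirichlet_char_1:
  assumes "dirichlet_char N \<psi>"
  shows "\<psi> (Suc 0) = 1"
  using dirichlet_charD(1)[OF assms, of 1 1] dirichlet_charD(3)[OF assms, of 1] by simp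

lemma dirichlet_char_power:
  assumes "dirichlet_char N \<psi>"
  shows "\<psi> (n ^ k) = \<psi> n ^ k"
  by (induction k) (simp_all add: dirichlet_charD(1)[OF assms] dirichlet_char_1[OF assms])

lemma dirichlet_char_power_totient:
  assumes "dirichlet_char N \<psi>" "coprime n N"
  shows "\<psi> n ^ totient N = 1"
proof -
  have "[n ^ totient N = 1] (mod N)" by (rule euler_theorem[OF assms(2)])
  thus ?thesis
    using dirichlet_char_cong[OF assms(1)] dirichlet_char_power[OF assms(1)] dirichlet_char_1[OF assms(1)]
    by (metis One_nat_def)
qed

lemma norm_dirichlet_char:
  assumes "dirichlet_char N \<psi>" "coprime n N" "N > 0"
  shows "norm (\<psi> n) = 1"
  using power_eq_1_iff[OF dirichlet_char_power_totient[OF assms(1,2)]] assms(3) by simp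

lemma norm_dirichlet_char_le_1:
  assumes "dirichlet_char N \<psi>" "N > 0"
  shows "norm (\<psi> n) \<le> 1"
  using norm_dirichlet_char[OF assms(1) _ assms(2), of n] dirichlet_charD(3)[OF assms(1), of n]
  by (cases "coprime n N") auto

lemma coprime_mod_self_left_nat: "coprime (n mod N) N \<longleftrightarrow> coprime n (N::nat)"
  by (cases "N = 0") auto

lemma dirichlet_char_principal: "dirichlet_char N (principal_char N)"
  by (auto simp: dirichlet_char_def principal_char_def coprime_mod_self_left_nat)

lemma dirichlet_char_mult:
  "dirichlet_char N \<psi> \<Longrightarrow> dirichlet_char N \<phi> \<Longrightarrow> dirichlet_char N (\<lambda>n. \<psi> n * \<phi> n)"
  unfolding dirichlet_char_def by auto

lemma dirichlet_char_cnj: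
  "dirichlet_char N \<psi> \<Longrightarrow> dirichlet_char N (\<lambda>n. cnj (\<psi> n))"
  unfolding dirichlet_char_def by auto

text \<open>A character is determined by one period, and its values are 0 or roots of unity of order
  dividing \<open>totient N\<close>.\<close>

lemma finite_dirichlet_char:
  assumes "N > 0"
  shows "finite {\<psi>. dirichlet_char N \<psi>}"
proof -
  define R where "R = insert 0 {z :: complex. z ^ totient N = 1}"
  have "totient N > 0" using assms by simp
  hence "finite {z :: complex. z ^ totient N = 1}"
    using finite_roots_unity[of "totient N"] by (simp add: Suc_le_eq)
  hence "finite R" by (simp add: R_def)
  hence fin: "finite ({..<N} \<rightarrow>\<^sub>E R)" by (simp add: finite_PiE)
  have "inj_on (\<lambda>\<psi>. restrict \<psi> {..<N}) {\<psi>. dirichlet_char N \<psi>}"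
  proof (rule inj_onI, rule ext)
    fix \<psi> \<phi> n
    assume "\<psi> \<in> {\<psi>. dirichlet_char N \<psi>}" "\<phi> \<in> {\<psi>. dirichlet_char N \<psi>}"
      and e: "restrict \<psi> {..<N} = restrict \<phi> {..<N}"
    moreover have "\<psi> (n mod N) = \<phi> (n mod N)"
      using fun_cong[OF e, of "n mod N"] assms by simp
    ultimately show "\<psi> n = \<phi> n"
      using dirichlet_charD(2) by (metis mem_Collect_eq)
  qed
  moreover have "(\<lambda>\<psi>. restrict \<psi> {..<N}) ` {\<psi>. dirichlet_char N \<psi>} \<subseteq> {..<N} \<rightarrow>\<^sub>E R"
  proof -
    have "\<psi> n \<in> R" if "dirichlet_char N \<psi>" for \<psi> n
      using dirichlet_char_power_totient[OF that] dirichlet_charD(3)[OF that] unfolding R_def by blast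
    thus ?thesis by (auto split: if_splits)
  qed
  ultimately show ?thesis using fin by (metis finite_imageD finite_subset)
qed

lemma dirichlet_char_separates:
  assumes N: "N > 1" and a: "coprime a N" "\<not> [a = 1] (mod N)"
  shows "\<exists>\<psi>. dirichlet_char N \<psi> \<and> \<psi> a \<noteq> 1"
proof -
  \<comment> \<open>The unit group modulo \<open>N\<close> on least residues; \<open>1 < N\<close>
    makes 1 its own residue.\<close>
  define G where "G = \<lparr>carrier = {n. n < N \<and> coprime n N}, monoid.mult = (\<lambda>x y. x * y mod N), one = (1::nat)\<rparr>"
  have G: "comm_group G"
  proof (rule comm_groupI)
    fix x assume x: "x \<in> carrier G"
    then obtain y where y: "[x * y = 1] (mod N)" using cong_solve_coprime_nat[of x N] by (auto simp: G_def)
    hence "coprime y N" 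
      by (metis coprime_iff_invertible_nat mult.commute One_nat_def)
    moreover have "y mod N * x mod N = 1"
      using y N by (simp add: cong_def mod_mult_left_eq mult.commute[of x])
    ultimately show "\<exists>y\<in>carrier G. y \<otimes>\<^bsub>G\<^esub> x = \<one>\<^bsub>G\<^esub>"
      using N by (intro bexI[of _ "y mod N"]) (auto simp: G_def)
  qed (use N in \<open>auto simp: G_def mod_mult_left_eq mod_mult_right_eq mult_ac\<close>)
  have aG: "a mod N \<in> carrier G" "a mod N \<noteq> \<one>\<^bsub>G\<^esub>" using N a by (auto simp: G_def cong_def)
  have "finite (carrier G)" by (simp add: G_def)
  then obtain \<phi> where \<phi>: "mult_character G (carrier G) \<phi>" "\<phi> (a mod N) \<noteq> 1"
    using comm_group.mult_character_separates[OF G _ aG] by blast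
  define \<psi> where "\<psi> = (\<lambda>n. if coprime n N then \<phi> (n mod N) else 0)"
  have "dirichlet_char N \<psi>"
    unfolding dirichlet_char_def
  proof (intro conjI allI)
    fix m n
    show "\<psi> (m * n) = \<psi> m * \<psi> n"
    proof (cases "coprime m N \<and> coprime n N")
      case True
      have "\<phi> (m mod N * (n mod N) mod N) = \<phi> (m mod N) * \<phi> (n mod N)"
        using \<phi>(1) True N unfolding mult_character_def by (auto simp: G_def)
      thus ?thesis using True by (simp add: \<psi>_def mod_mult_eq)
    qed (auto simp: \<psi>_def)
  next
    fix n
    show "\<psi> (n mod N) = \<psi> n" by (simp add: \<psi>_def coprime_mod_self_left_nat)
    show "(\<psi> n \<noteq> 0) = coprime n N"
      using \<phi>(1) N unfolding mult_character_def by (auto simp: G_def \<psi>_def)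
  qed
  thus ?thesis using \<phi>(2) a(1) by (auto simp: \<psi>_def)
qed

text \<open>Multiplication by a unit \<open>a\<close> with \<open>\<psi> a \<noteq> 1\<close>
  permutes the residues, so the sum equals \<open>\<psi> a\<close> times itself.\<close>

lemma sum_dirichlet_char_period:
  assumes \<psi>: "dirichlet_char N \<psi>" "\<psi> \<noteq> principal_char N" and N: "N > 0"
  shows "(\<Sum>n<N. \<psi> n) = 0"
proof -
  obtain a where a: "coprime a N" "\<psi> a \<noteq> 1"
    using \<psi> dirichlet_charD(3)[OF \<psi>(1)] unfolding principal_char_def fun_eq_iff by metis
  have inj: "inj_on (\<lambda>n. a * n mod N) {..<N}"
  proof (rule inj_onI)
    fix x y assume "x \<in> {..<N}" "y \<in> {..<N}" "a * x mod N = a * y mod N"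
    thus "x = y" using a(1) by (metis cong_def cong_mult_lcancel_nat lessThan_iff mod_less)
  qed
  have im: "(\<lambda>n. a * n mod N) ` {..<N} = {..<N}"
    by (rule endo_inj_surj[OF _ _ inj]) (use N in auto)
  have "(\<Sum>n<N. \<psi> n) = (\<Sum>n<N. \<psi> (a * n mod N))"
    using sum.reindex[OF inj, of \<psi>] im by (simp add: o_def)
  also have "\<dots> = \<psi> a * (\<Sum>n<N. \<psi> n)"
    by (simp add: dirichlet_charD[OF \<psi>(1)] sum_distrib_left)
  finally have "(1 - \<psi> a) * (\<Sum>n<N. \<psi> n) = 0" by (simp add: algebra_simps)
  thus ?thesis using a(2) by simp
qed

lemma norm_sum_dirichlet_char_le:
  assumes \<psi>: "dirichlet_char N \<psi>" "\<psi> \<noteq> principal_char N" and N: "N > 0"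
  shows "norm (\<Sum>n<k. \<psi> n) \<le> N"
proof -
  have step: "(\<Sum>n<r + N * q. \<psi> n) = (\<Sum>n<r. \<psi> n)" for r q
  proof (induction q)
    case (Suc q)
    \<comment> \<open>Sliding a window of length \<open>N\<close> by one exchanges
      \<open>\<psi> t\<close> for the equal value \<open>\<psi> (t + N)\<close>, so every such
      window sums to 0.\<close>
    have per: "(\<Sum>n<N. \<psi> (t + n)) = 0" for t
    proof (induction t)
      case (Suc t)
      have "(\<Sum>n<N. \<psi> (Suc t + n)) + \<psi> t = (\<Sum>n<Suc N. \<psi> (t + n))"
        by (subst sum.lessThan_Suc_shift) simp
      also have "\<dots> = \<psi> (t + N)" using Suc by simp
      also have "\<dots> = \<psi> t" using dirichlet_char_cong[OF \<psi>(1), of "t + N" t] by (simp add: cong_def)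
      finally show ?case by simp
    qed (use sum_dirichlet_char_period[OF assms] in simp)
    have "(\<Sum>n<t + k. \<psi> n) = (\<Sum>n<t. \<psi> n) + (\<Sum>n<k. \<psi> (t + n))" for t k
      by (induction k) simp_all
    from this[of "r + N * q" N]
    show ?case using Suc per[of "r + N * q"] by (simp add: algebra_simps)
  qed simp
  have "(\<Sum>n<k. \<psi> n) = (\<Sum>n<k mod N. \<psi> n)"
    using step[of "k mod N" "k div N"] by simp
  also have "norm \<dots> \<le> (\<Sum>n<k mod N. 1)"
    by (rule sum_norm_le) (use norm_dirichlet_char_le_1[OF \<psi>(1) N] in simp)
  also have "\<dots> \<le> N" using mod_less_divisor[OF N, of k] by simp
  finally show ?thesis .
qed

text \<open>If \<open>n\<close> is a unit other than 1, some character \<phi> has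
  \<open>\<phi> n \<noteq> 1\<close>. Multiplication by \<phi> permutes the characters, so the sum
  equals \<open>\<phi> n\<close> times itself.\<close>

lemma sum_characters:
  assumes N: "N > 1"
  shows "(\<Sum>\<psi> | dirichlet_char N \<psi>. \<psi> n) = (if [n = 1] (mod N) then of_nat (card {\<psi>. dirichlet_char N \<psi>}) else 0)"
proof -
  consider "[n = 1] (mod N)" | "\<not> coprime n N" | "coprime n N" "\<not> [n = 1] (mod N)" by blast
  thus ?thesis
  proof cases
    case 1
    hence "\<psi> n = 1" if "dirichlet_char N \<psi>" for \<psi>
      using dirichlet_char_cong[OF that 1] dirichlet_char_1[OF that] by simp
    hence "(\<Sum>\<psi> | dirichlet_char N \<psi>. \<psi> n) = (\<Sum>\<psi> | dirichlet_char N \<psi>. 1)"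
      by (intro sum.cong) auto
    thus ?thesis using 1 by simp
  next
    case 2
    hence "\<not> [n = 1] (mod N)" using cong_imp_coprime[of 1 n N] by (metis cong_sym coprime_1_left)
    thus ?thesis using 2 dirichlet_charD(3) by (auto intro!: sum.neutral)
  next
    case 3
    then obtain \<phi> where \<phi>: "dirichlet_char N \<phi>" "\<phi> n \<noteq> 1"
      using dirichlet_char_separates[OF N] by blast
    \<comment> \<open>Conjugation inverts \<phi> only up to the principal character, which every
      character absorbs.\<close>
    have "\<phi> k * cnj (\<phi> k) = principal_char N k" for k
    proof (cases "coprime k N")
      case True
      thus ?thesis using norm_dirichlet_char[OF \<phi>(1) True] N
        by (simp add: principal_char_def complex_norm_square[symmetric])
    qed (use dirichlet_charD(3)[OF \<phi>(1)] in \<open>auto simp: principal_char_def\<close>)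
    moreover have "principal_char N k * \<psi> k = \<psi> k" if "dirichlet_char N \<psi>" for \<psi> k
      using dirichlet_charD(3)[OF that] by (auto simp: principal_char_def)
    ultimately have inv: "\<phi> k * (cnj (\<phi> k) * \<psi> k) = \<psi> k" "cnj (\<phi> k) * (\<phi> k * \<psi> k) = \<psi> k"
      if "dirichlet_char N \<psi>" for \<psi> k
      using that by (metis mult.assoc mult.commute)+
    have "(\<Sum>\<psi> | dirichlet_char N \<psi>. \<psi> n) = (\<Sum>\<psi> | dirichlet_char N \<psi>. \<phi> n * \<psi> n)"
      by (rule sum.reindex_bij_witness[of _ "\<lambda>\<psi> k. \<phi> k * \<psi> k" "\<lambda>\<psi> k. cnj (\<phi> k) * \<psi> k"])
         (use inv \<phi>(1) in \<open>auto intro!: dirichlet_char_mult dirichlet_char_cnj\<close>)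
    hence "(1 - \<phi> n) * (\<Sum>\<psi> | dirichlet_char N \<psi>. \<psi> n) = 0"
      by (simp add: left_diff_distrib flip: sum_distrib_left)
    thus ?thesis using 3 \<phi>(2) by simp
  qed
qed

section \<open>Dirichlet series of a real argument\<close>

text \<open>Abel summation moves the differences onto \<open>b\<close>. For a monotone weight they
  telescope, so the bound does not depend on \<open>n\<close>.\<close>

lemma norm_sum_mult_decreasing_le:
  fixes f :: "nat \<Rightarrow> complex" and b :: "nat \<Rightarrow> real"
  assumes C: "\<And>n. norm (\<Sum>k<n. f k) \<le> C"
    and dec: "\<And>k. k \<ge> m \<Longrightarrow> b (Suc k) \<le> b k" and nn: "\<And>k. k \<ge> m \<Longrightarrow> 0 \<le> b k" and "m \<le> n"
  shows "norm (\<Sum>k=m..<n. f k * of_real (b k)) \<le> 2 * C * b m"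
proof -
  define F where "F = (\<lambda>n. \<Sum>k<n. f k)"
  have parts: "(\<Sum>k=m..<n. f k * of_real (b k)) =
    F n * of_real (b n) - F m * of_real (b m) + (\<Sum>k=m..<n. F (Suc k) * of_real (b k - b (Suc k)))"
    using \<open>m \<le> n\<close> by (induction n rule: dec_induct) (auto simp: F_def algebra_simps)
  have 1: "norm (F n * of_real (b n)) \<le> C * b n"
    using C[of n] nn[OF \<open>m \<le> n\<close>] by (simp add: norm_mult F_def mult_right_mono)
  have 2: "norm (F m * of_real (b m)) \<le> C * b m"
    using C[of m] nn[of m] by (simp add: norm_mult F_def mult_right_mono)
  have "norm (\<Sum>k=m..<n. F (Suc k) * of_real (b k - b (Suc k))) \<le> (\<Sum>k=m..<n. C * (b k - b (Suc k)))"
  proof (rule sum_norm_le)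
    fix k assume "k \<in> {m..<n}"
    hence "b (Suc k) \<le> b k" using dec by simp
    thus "norm (F (Suc k) * of_real (b k - b (Suc k))) \<le> C * (b k - b (Suc k))"
      using C[of "Suc k"] by (simp add: norm_mult F_def mult_right_mono del: of_real_diff sum.lessThan_Suc)
  qed
  also have "\<dots> = C * (b m - b n)"
    using \<open>m \<le> n\<close> by (induction n rule: dec_induct) (auto simp: algebra_simps)
  finally have 3: "norm (\<Sum>k=m..<n. F (Suc k) * of_real (b k - b (Suc k))) \<le> C * (b m - b n)" .
  have "norm (X - Y + Z) \<le> norm X + norm Y + norm Z" for X Y Z :: complex
    by (rule order.trans[OF norm_triangle_ineq]) (simp add: norm_triangle_ineq4)
  hence "norm (\<Sum>k=m..<n. f k * of_real (b k)) \<le> C * b n + C * b m + C * (b m - b n)"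
    unfolding parts by (rule order.trans) (intro add_mono 1 2 3)
  thus ?thesis by (simp add: algebra_simps)
qed

text \<open>Monotonicity is required only from \<open>m\<close> on, because ln n / n^s is known to
  decrease only from 3 on. The explicit tail bound later yields convergence that is uniform in
  \<open>s\<close>.\<close>

lemma
  fixes f :: "nat \<Rightarrow> complex" and b :: "nat \<Rightarrow> real"
  assumes C: "\<And>n. norm (\<Sum>k<n. f k) \<le> C"
    and dec: "\<And>k. k \<ge> m \<Longrightarrow> b (Suc k) \<le> b k" and lim: "b \<longlonglongrightarrow> 0"
  shows dirichlet_test_summable: "summable (\<lambda>k. f k * of_real (b k))"
    and dirichlet_test_tail: "m \<le> n \<Longrightarrow> norm ((\<Sum>k<n. f k * of_real (b k)) - (\<Sum>k. f k * of_real (b k))) \<le> 2 * C * b n"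
proof -
  have dec': "b j \<le> b i" if "m \<le> i" "i \<le> j" for i j
    using that(2) by (induction j rule: dec_induct) (use dec that(1) in \<open>auto intro: order.trans\<close>)
  have nn: "0 \<le> b k" if "k \<ge> m" for k
    by (rule LIMSEQ_le_const2[OF lim]) (use dec' that in auto)
  have C0: "C \<ge> 0" using C[of 0] by simp
  have bd: "norm (\<Sum>k=i..<j. f k * of_real (b k)) \<le> 2 * C * b i" if "m \<le> i" "i \<le> j" for i j
    using that by (intro norm_sum_mult_decreasing_le C dec nn) auto
  show sm: "summable (\<lambda>k. f k * of_real (b k))"
    unfolding summable_Cauchy
  proof (intro allI impI)
    fix e :: real assume e: "e > 0"
    have "(\<lambda>i. 2 * C * b i) \<longlonglongrightarrow> 2 * C * 0" by (intro tendsto_intros lim)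
    hence "eventually (\<lambda>i. 2 * C * b i < e) sequentially" using e by (simp add: order_tendstoD(2))
    then obtain M where M: "\<And>i. i \<ge> M \<Longrightarrow> 2 * C * b i < e"
      unfolding eventually_sequentially by blast
    have "norm (\<Sum>k=i..<j. f k * of_real (b k)) < e" if "i \<ge> max M m" for i j
      using bd[of i j] M[of i] that e by (cases "i \<le> j") auto
    thus "\<exists>N. \<forall>i\<ge>N. \<forall>j. norm (\<Sum>k=i..<j. f k * of_real (b k)) < e" by blast
  qed
  show "norm ((\<Sum>k<n. f k * of_real (b k)) - (\<Sum>k. f k * of_real (b k))) \<le> 2 * C * b n" if "m \<le> n"
  proof -
    have "(\<lambda>j. norm ((\<Sum>k<n. f k * of_real (b k)) - (\<Sum>k<j. f k * of_real (b k)))) \<longlonglongrightarrow>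
       norm ((\<Sum>k<n. f k * of_real (b k)) - (\<Sum>k. f k * of_real (b k)))"
      by (intro tendsto_intros summable_LIMSEQ sm)
    moreover have "norm ((\<Sum>k<n. f k * of_real (b k)) - (\<Sum>k<j. f k * of_real (b k))) \<le> 2 * C * b n" if "j \<ge> n" for j
    proof -
      have "(\<Sum>k<j. f k * of_real (b k)) - (\<Sum>k<n. f k * of_real (b k)) = (\<Sum>k=n..<j. f k * of_real (b k))"
        using that by (simp add: lessThan_atLeast0 sum_diff_nat_ivl)
      thus ?thesis using bd[OF \<open>m \<le> n\<close> that] by (metis norm_minus_commute)
    qed
    ultimately show ?thesis by (intro LIMSEQ_le_const2) auto
  qed
qed

text \<open>In all three series the term for $n = 0$ vanishes, since \<open>0 powr x = 0\<close> and \<open>ln 0 = 0\<close>.\<close>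

definition dseries :: "(nat \<Rightarrow> complex) \<Rightarrow> real \<Rightarrow> complex" where
  "dseries f s = (\<Sum>n. f n * of_real (real n powr - s))"

definition dseries_ln :: "(nat \<Rightarrow> complex) \<Rightarrow> real \<Rightarrow> complex" where
  "dseries_ln f s = (\<Sum>n. f n * of_real (ln (real n) * real n powr - s))"

definition dseries_mangoldt :: "(nat \<Rightarrow> complex) \<Rightarrow> real \<Rightarrow> complex" where
  "dseries_mangoldt f s = (\<Sum>n. f n * of_real (mangoldt n * real n powr - s))"

text \<open>Termwise differentiation needs the differentiated series to converge uniformly on
  \<open>S\<close>, which is what the null sequence \<epsilon> expresses. Two regimes share it:
  bounded partial sums on the closed half-line from 1, and absolute convergence to the right of
  1.\<close>

lemma dseries_has_derivative:
  assumes S: "convex S" "s \<in> S" and t: "t \<in> S" "summable (\<lambda>n. f n * of_real (real n powr - t))"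
    and \<epsilon>: "\<epsilon> \<longlonglongrightarrow> 0"
    and tail: "\<And>n x. n \<ge> M \<Longrightarrow> x \<in> S \<Longrightarrow>
      norm ((\<Sum>i<n. f i * of_real (ln (real i) * real i powr - x)) - dseries_ln f x) \<le> \<epsilon> n"
  shows "summable (\<lambda>n. f n * of_real (real n powr - s))"
    and "(dseries f has_vector_derivative - dseries_ln f s) (at s within S)"
proof -
  define d where "d = (\<lambda>i x. f i * of_real (ln (real i) * real i powr - x))"
  have "\<exists>g. \<forall>x\<in>S. (\<lambda>n. f n * of_real (real n powr - x)) sums g x \<and>
      (g has_derivative (\<lambda>h. h *\<^sub>R - dseries_ln f x)) (at x within S)"
  proof (rule has_derivative_series[where f' = "\<lambda>i x h. h *\<^sub>R - d i x"])
    fix i x assume "x \<in> S"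
    have "((\<lambda>x. real i powr - x) has_real_derivative - (ln (real i) * real i powr - x)) (at x within S)"
    proof (cases "i = 0")
      case False
      have "(\<lambda>x. real i powr - x) = (\<lambda>x. exp (- (x * ln (real i))))"
        using False by (simp add: powr_def)
      thus ?thesis
        using False by (auto intro!: derivative_eq_intros simp: powr_def)
    qed simp
    hence "((\<lambda>x. f i * of_real (real i powr - x)) has_vector_derivative
       f i * of_real (- (ln (real i) * real i powr - x))) (at x within S)"
      by (intro has_vector_derivative_mult_right has_vector_derivative_of_real)
    thus "((\<lambda>x. f i * of_real (real i powr - x)) has_derivative (\<lambda>h. h *\<^sub>R - d i x)) (at x within S)"
      by (simp add: has_vector_derivative_def d_def)
  next
    fix e :: real assume "e > 0"
    hence "eventually (\<lambda>n. \<epsilon> n < e) sequentially" using \<epsilon> by (simp add: order_tendstoD(2))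
    thus "\<forall>\<^sub>F n in sequentially. \<forall>x\<in>S. \<forall>h. norm ((\<Sum>i<n. h *\<^sub>R - d i x) - h *\<^sub>R - dseries_ln f x) \<le> e * norm h"
      using eventually_ge_at_top[of M]
    proof eventually_elim
      case (elim n)
      show ?case
      proof (intro ballI allI)
        fix x h assume x: "x \<in> S"
        have "(\<Sum>i<n. h *\<^sub>R - d i x) - h *\<^sub>R - dseries_ln f x = - (h *\<^sub>R ((\<Sum>i<n. d i x) - dseries_ln f x))"
          by (simp add: scaleR_right_diff_distrib sum_negf scaleR_sum_right)
        also have "norm \<dots> = norm h * norm ((\<Sum>i<n. d i x) - dseries_ln f x)" by simp
        also have "\<dots> \<le> norm h * e"
          using tail[OF elim(2) x] elim(1) by (intro mult_left_mono) (auto simp: d_def)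
        finally show "norm ((\<Sum>i<n. h *\<^sub>R - d i x) - h *\<^sub>R - dseries_ln f x) \<le> e * norm h"
          by (simp add: mult.commute)
      qed
    qed
  next
    show "(\<lambda>n. f n * of_real (real n powr - t)) sums (\<Sum>n. f n * of_real (real n powr - t))"
      using t(2) by (rule summable_sums)
  qed (use S t in auto)
  then obtain g where g: "\<And>x. x \<in> S \<Longrightarrow> (\<lambda>n. f n * of_real (real n powr - x)) sums g x"
      "\<And>x. x \<in> S \<Longrightarrow> (g has_derivative (\<lambda>h. h *\<^sub>R - dseries_ln f x)) (at x within S)"
    by blast
  show "summable (\<lambda>n. f n * of_real (real n powr - s))" using g(1)[OF S(2)] by (rule sums_summable)
  have "dseries f x = g x" if "x \<in> S" for x
    using g(1)[OF that] by (simp add: dseries_def sums_iff)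
  thus "(dseries f has_vector_derivative - dseries_ln f s) (at s within S)"
    using g(2)[OF S(2)] S(2) unfolding has_vector_derivative_def
    by (metis (no_types, lifting) has_derivative_transform)
qed

text \<open>The factor ln x / x decreases once ln x is at least 1, thus from 3 > e on, and the
  remaining factor x^(1 - s) does not increase.\<close>

lemma ln_over_decreasing:
  assumes "n \<ge> 3" "s \<ge> 1"
  shows "ln (real (Suc n)) * real (Suc n) powr - s \<le> ln (real n) * real n powr - s"
proof -
  define x where "x = real n"
  have x: "x \<ge> 3" using assms by (simp add: x_def)
  have "1 \<le> ln x" using exp_le x by (subst ln_ge_iff) linarith+
  moreover have "ln (x + 1) - ln x \<le> 1 / x"
    using ln_add_one_self_le_self[of "1 / x"] x ln_div[of "x + 1" x] by (simp add: add_divide_distrib)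
  hence "x * (ln (x + 1) - ln x) \<le> 1" using x by (simp add: field_simps)
  ultimately have "x * ln (x + 1) \<le> (x + 1) * ln x" by (simp add: algebra_simps)
  hence 1: "ln (x + 1) / (x + 1) \<le> ln x / x" using x by (simp add: field_simps)
  have 2: "(x + 1) powr (1 - s) \<le> x powr (1 - s)" using x assms by (intro powr_mono2') auto
  have e: "y powr - s = y powr (1 - s) / y" if "y > 0" for y :: real
    using that by (simp add: powr_diff powr_minus field_simps)
  have "ln (x + 1) / (x + 1) * (x + 1) powr (1 - s) \<le> ln x / x * x powr (1 - s)"
    using 1 2 x by (intro mult_mono) auto
  thus ?thesis using e[of x] e[of "x + 1"] x by (simp add: x_def add.commute)
qed

lemma ln_times_powr_le:
  assumes "s \<ge> 1" "n \<ge> 1"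
  shows "ln (real n) * real n powr - s \<le> ln (real n) / real n"
proof -
  have "real n powr - s \<le> real n powr -1" using assms by (intro powr_mono) auto
  hence "ln (real n) * real n powr - s \<le> ln (real n) * real n powr -1" using assms by (intro mult_left_mono) auto
  thus ?thesis using assms by (simp add: powr_minus divide_inverse)
qed

text \<open>Bounded partial sums reach the endpoint \<open>s = 1\<close>, where absolute convergence
  may fail. The derivative is taken within \<open>{1..}\<close>, hence one-sided at 1, and its bound
  is uniform in \<open>s\<close>.\<close>

lemma
  assumes C: "\<And>n. norm (\<Sum>k<n. f k) \<le> C" and s: "s \<ge> 1"
  shows bounded_sums_dseries_summable: "summable (\<lambda>n. f n * of_real (real n powr - s))"
    and bounded_sums_dseries_deriv: "(dseries f has_vector_derivative - dseries_ln f s) (at s within {1..})"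
    and bounded_sums_dseries_ln_bound: "norm (dseries_ln f s) \<le> norm (f 2) * ln 2 + 2 * C * ln 3"
proof -
  have ln0: "(\<lambda>n. ln (real n) / real n) \<longlonglongrightarrow> 0" by real_asymp
  have C0: "C \<ge> 0" using C[of 0] by simp
  have tail: "norm ((\<Sum>i<n. f i * of_real (ln (real i) * real i powr - x)) - dseries_ln f x) \<le> 2 * C * (ln (real n) / real n)"
    if "n \<ge> 3" "x \<in> {1..}" for n x
  proof -
    have "norm ((\<Sum>i<n. f i * of_real (ln (real i) * real i powr - x)) - dseries_ln f x) \<le> 2 * C * (ln (real n) * real n powr - x)"
      unfolding dseries_ln_def
    proof (rule dirichlet_test_tail[where m = 3])
      show "(\<lambda>n. ln (real n) * real n powr - x) \<longlonglongrightarrow> 0"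
      proof (rule tendsto_sandwich[OF _ _ tendsto_const ln0])
        show "\<forall>\<^sub>F n in sequentially. 0 \<le> ln (real n) * real n powr - x"
          using eventually_ge_at_top[of 1] by eventually_elim auto
        show "\<forall>\<^sub>F n in sequentially. ln (real n) * real n powr - x \<le> ln (real n) / real n"
          using eventually_ge_at_top[of 1] by eventually_elim (use that ln_times_powr_le in auto)
      qed
    qed (use that C ln_over_decreasing in auto)
    also have "\<dots> \<le> 2 * C * (ln (real n) / real n)"
      using that C0 by (intro mult_left_mono ln_times_powr_le) auto
    finally show ?thesis .
  qed
  have sm: "summable (\<lambda>n. f n * of_real (real n powr - s))" if "s \<ge> 1" for s
  proof (rule dirichlet_test_summable[OF C, where m = 1])
    show "real (Suc k) powr - s \<le> real k powr - s" if "k \<ge> 1" for k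
      using that \<open>s \<ge> 1\<close> by (intro powr_mono2') auto
    show "(\<lambda>n. real n powr - s) \<longlonglongrightarrow> 0" using \<open>s \<ge> 1\<close> by real_asymp
  qed
  show "summable (\<lambda>n. f n * of_real (real n powr - s))" using sm s by blast
  show "(dseries f has_vector_derivative - dseries_ln f s) (at s within {1..})"
  proof (rule dseries_has_derivative(2)[where t = 1 and M = 3])
    show "(\<lambda>n. 2 * C * (ln (real n) / real n)) \<longlonglongrightarrow> 0"
      using tendsto_mult_left[OF ln0, of "2 * C"] by simp
  qed (use s sm[of 1] tail in auto)
  \<comment> \<open>The tail estimate starts at 3; of the terms before it only \<open>i = 2\<close>
    survives, since \<open>ln\<close> vanishes at 0 and 1.\<close>
  have "norm (\<Sum>i<3. f i * of_real (ln (real i) * real i powr - s)) \<le> norm (f 2) * ln 2"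
  proof -
    have "(\<Sum>i<3. f i * of_real (ln (real i) * real i powr - s)) = f 2 * of_real (ln 2 * 2 powr - s)"
      by (simp add: numeral_3_eq_3 numeral_2_eq_2)
    moreover have "2 powr - s \<le> (1::real)" using s powr_mono[of "-s" 0 "2::real"] by simp
    ultimately show ?thesis by (simp add: norm_mult mult_left_mono)
  qed
  moreover have "norm ((\<Sum>i<3. f i * of_real (ln (real i) * real i powr - s)) - dseries_ln f s) \<le> 2 * C * ln 3"
  proof -
    have "2 * C * (ln 3 / 3) \<le> 2 * C * ln 3" using C0 by (intro mult_left_mono) auto
    thus ?thesis using tail[of 3 s] s by simp
  qed
  ultimately show "norm (dseries_ln f s) \<le> norm (f 2) * ln 2 + 2 * C * ln 3"
    using norm_triangle_sub[of "dseries_ln f s" "\<Sum>i<3. f i * of_real (ln (real i) * real i powr - s)"]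
      norm_minus_commute[of "dseries_ln f s" "\<Sum>i<3. f i * of_real (ln (real i) * real i powr - s)"]
    by linarith
qed

lemma summable_ln_powr:
  assumes "s > (1::real)"
  shows "summable (\<lambda>n. ln (real n) * real n powr - s)"
proof -
  \<comment> \<open>Half of the excess of \<open>s\<close> over 1 pays for the logarithm, and the
    exponent \<open>a - s\<close> is still below -1.\<close>
  define a where "a = (s - 1) / 2"
  have a: "a > 0" using assms by (simp add: a_def)
  have "summable (\<lambda>n. real n powr (a - s) / a)"
    using assms by (intro summable_divide) (simp add: summable_real_powr_iff a_def field_simps)
  thus ?thesis
  proof (rule summable_comparison_test'[where N = 1])
    fix n :: nat assume n: "n \<ge> 1"
    have "ln (real n) * real n powr - s \<le> real n powr a / a * real n powr - s"
      using n a by (intro mult_right_mono ln_powr_bound) auto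
    thus "norm (ln (real n) * real n powr - s) \<le> real n powr (a - s) / a"
      using n by (simp add: powr_diff powr_minus field_simps)
  qed
qed

lemma
  assumes f: "\<And>n. norm (f n) \<le> 1" and s: "s > 1"
  shows dseries_abs_summable: "summable (\<lambda>n. norm (f n * of_real (real n powr - s)))"
    and dseries_ln_abs_summable: "summable (\<lambda>n. norm (f n * of_real (ln (real n) * real n powr - s)))"
    and dseries_mangoldt_abs_summable: "summable (\<lambda>n. norm (f n * of_real (mangoldt n * real n powr - s)))"
    and dseries_deriv: "(dseries f has_vector_derivative - dseries_ln f s) (at s)"
proof -
  have dom: "norm (f n * of_real x) \<le> y" if "\<bar>x\<bar> \<le> y" for n x y
  proof -
    have "norm (f n) * \<bar>x\<bar> \<le> 1 * \<bar>x\<bar>" using f[of n] by (intro mult_right_mono) auto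
    thus ?thesis using that by (simp add: norm_mult)
  qed
  have ln_nn: "ln (real n) \<ge> 0" for n by (cases "n = 0") auto
  show "summable (\<lambda>n. norm (f n * of_real (real n powr - s)))"
  proof (rule summable_comparison_test'[where N = 0])
    show "summable (\<lambda>n. real n powr - s)" using s by (simp add: summable_real_powr_iff)
    show "norm (norm (f n * of_real (real n powr - s))) \<le> real n powr - s" for n
      unfolding real_norm_def abs_norm_cancel by (rule dom) simp
  qed
  show l: "summable (\<lambda>n. norm (f n * of_real (ln (real n) * real n powr - s)))"
    using summable_ln_powr[OF s] 
  proof (rule summable_comparison_test'[where N = 0])
    show "norm (norm (f n * of_real (ln (real n) * real n powr - s))) \<le> ln (real n) * real n powr - s" for n
      unfolding real_norm_def abs_norm_cancel by (rule dom) (use ln_nn[of n] in \<open>simp add: abs_mult\<close>)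
  qed
  show "summable (\<lambda>n. norm (f n * of_real (mangoldt n * real n powr - s)))"
    using summable_ln_powr[OF s]
  proof (rule summable_comparison_test'[where N = 1])
    fix n :: nat assume n: "n \<ge> 1"
    have "mangoldt n * real n powr - s \<le> ln (real n) * real n powr - s"
      using mangoldt_le[of n] n by (intro mult_right_mono) auto
    hence "\<bar>mangoldt n * real n powr - s\<bar> \<le> ln (real n) * real n powr - s"
      by (simp add: abs_mult)
    from dom[OF this] show "norm (norm (f n * of_real (mangoldt n * real n powr - s))) \<le> ln (real n) * real n powr - s"
      by simp
  qed
  \<comment> \<open>The dominating tail is taken at a fixed \<open>r\<close> between 1 and
    \<open>s\<close>. The half-line beyond \<open>r\<close> is open, so the derivative within it is
    the full derivative at \<open>s\<close>.\<close>
  define r where "r = (1 + s) / 2"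
  have r: "1 < r" "r < s" using s by (auto simp: r_def)
  have "(dseries f has_vector_derivative - dseries_ln f s) (at s within {r<..})"
  proof (rule dseries_has_derivative(2)[where t = s and M = 0])
    show "(\<lambda>n. (\<Sum>i. ln (real (i + n)) * real (i + n) powr - r)) \<longlonglongrightarrow> 0"
      using summable_ln_powr[OF r(1)] by (rule suminf_exist_split2)
    fix n :: nat and x assume "x \<in> {r<..}"
    hence x: "x > r" by simp
    have le: "norm (f i * of_real (ln (real i) * real i powr - x)) \<le> ln (real i) * real i powr - r" for i
    proof (rule dom, cases "i = 0")
      case False
      hence "ln (real i) * real i powr - x \<le> ln (real i) * real i powr - r"
        using x by (intro mult_left_mono powr_mono) auto
      thus "\<bar>ln (real i) * real i powr - x\<bar> \<le> ln (real i) * real i powr - r" using ln_nn by (simp add: abs_mult)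
    qed simp
    have sm: "summable (\<lambda>i. f i * of_real (ln (real i) * real i powr - x))"
      using summable_ln_powr[OF r(1)] by (rule summable_comparison_test'[where N = 0]) (use le in auto)
    have "(\<Sum>i<n. f i * of_real (ln (real i) * real i powr - x)) - dseries_ln f x
       = - (\<Sum>i. f (i + n) * of_real (ln (real (i + n)) * real (i + n) powr - x))"
      using suminf_split_initial_segment[OF sm, of n] by (simp add: dseries_ln_def)
    also have "norm \<dots> \<le> (\<Sum>i. ln (real (i + n)) * real (i + n) powr - r)"
      unfolding norm_minus_cancel
      by (rule norm_suminf_le[OF le summable_ignore_initial_segment[OF summable_ln_powr[OF r(1)]]])
    finally show "norm ((\<Sum>i<n. f i * of_real (ln (real i) * real i powr - x)) - dseries_ln f x)
      \<le> (\<Sum>i. ln (real (i + n)) * real (i + n) powr - r)" .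
  qed (use r \<open>summable (\<lambda>n. norm (f n * of_real (real n powr - s)))\<close> in \<open>auto intro: summable_norm_cancel\<close>)
  thus "(dseries f has_vector_derivative - dseries_ln f s) (at s)"
    using r by (simp add: at_within_open[of s "{r<..}"])
qed

section \<open>Dirichlet convolution and divisor sums\<close>

lemma has_sum_divisors:
  fixes F :: "nat \<times> nat \<Rightarrow> 'a :: {comm_monoid_add, uniform_space, uniform_topological_group_add}"
  assumes "(F has_sum S) ({0<..} \<times> {0<..})"
  shows "((\<lambda>n. \<Sum>d | d dvd n. F (d, n div d)) has_sum S) {0<..}"
proof (rule has_sum_Sigma'[where f = "\<lambda>(n, d). F (d, n div d)" and B = "\<lambda>n. {d. d dvd n}"])
  have "bij_betw (\<lambda>(n, d). (d, n div d)) (SIGMA n:{0<..}. {d. d dvd n}) ({0<..} \<times> ({0<..} :: nat set))"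
  proof (rule bij_betw_byWitness[where f' = "\<lambda>(d, m). (d * m, d)"])
    have "0 < d \<and> 0 < n div d" if "d dvd n" "0 < n" for d n :: nat
      using that by (metis dvd_div_eq_0_iff dvd_pos_nat neq0_conv)
    thus "(\<lambda>(n, d). (d, n div d)) ` (SIGMA n:{0<..}. {d. d dvd n}) \<subseteq> {0<..} \<times> ({0<..} :: nat set)"
      by auto
  qed auto
  from has_sum_reindex_bij_betw[OF this, of F S]
  show "((\<lambda>(n, d). F (d, n div d)) has_sum S) (SIGMA n:{0<..}. {d. d dvd n})"
    using assms by (simp add: case_prod_unfold)
qed (auto intro!: has_sum_finite)

lemma has_sum_times:
  fixes f g :: "nat \<Rightarrow> complex"
  assumes f: "summable (\<lambda>n. norm (f n))" "f 0 = 0" and g: "summable (\<lambda>n. norm (g n))" "g 0 = 0"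
  shows "((\<lambda>(n, m). f n * g m) has_sum (\<Sum>n. f n) * (\<Sum>n. g n)) ({0<..} \<times> {0<..})"
proof -
  have pos: "(h has_sum (\<Sum>n. h n)) {0<..}" "(\<lambda>n. norm (h n)) summable_on {0<..}"
    if h: "summable (\<lambda>n. norm (h n))" "h 0 = 0" for h :: "nat \<Rightarrow> complex"
  proof -
    have "(h has_sum (\<Sum>n. h n)) UNIV"
      by (rule norm_summable_imp_has_sum[OF h(1) summable_sums[OF summable_norm_cancel[OF h(1)]]])
    thus "(h has_sum (\<Sum>n. h n)) {0<..}"
      by (rule has_sum_cong_neutral[THEN iffD1, rotated -1]) (use h(2) in auto)
    have "(\<lambda>n. norm (h n)) summable_on UNIV"
      using h(1) by (simp add: summable_on_UNIV_nonneg_real_iff)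
    thus "(\<lambda>n. norm (h n)) summable_on {0<..}" by (rule summable_on_subset_banach) simp
  qed
  note F = pos[OF f] and G = pos[OF g]
  show ?thesis
  proof (rule has_sum_SigmaI)
    show "((\<lambda>m. case (n, m) of (n, m) \<Rightarrow> f n * g m) has_sum f n * (\<Sum>m. g m)) {0<..}" for n
      using has_sum_cmult_right[OF G(1)] by simp
    show "((\<lambda>n. f n * (\<Sum>m. g m)) has_sum (\<Sum>n. f n) * (\<Sum>n. g n)) {0<..}"
      by (rule has_sum_cmult_left[OF F(1)])
    have "(\<lambda>p. norm (case p of (n, m) \<Rightarrow> f n * g m)) summable_on {0<..} \<times> {0<..}"
      unfolding Infinite_Sum.abs_summable_on_Sigma_iff
    proof (intro conjI ballI)
      show "(\<lambda>m. norm (case (n, m) of (n, m) \<Rightarrow> f n * g m)) summable_on {0<..}" for n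
        using summable_on_cmult_right[OF G(2), of "norm (f n)"] by (simp add: norm_mult)
      have "infsum (\<lambda>m. norm (f n) * norm (g m)) {0<..} = norm (f n) * infsum (\<lambda>m. norm (g m)) {0<..}" for n
        using G(2) by (simp add: infsum_cmult_right)
      moreover have "infsum (\<lambda>m. norm (g m)) {0<..} \<ge> 0" by (simp add: infsum_nonneg)
      ultimately show "(\<lambda>n. norm (\<Sum>\<^sub>\<infinity>m\<in>{0<..}. norm (case (n, m) of (n, m) \<Rightarrow> f n * g m))) summable_on {0<..}"
        using summable_on_cmult_left[OF F(2), of "infsum (\<lambda>m. norm (g m)) {0<..}"]
        by (simp add: norm_mult)
    qed
    thus "(\<lambda>(n, m). f n * g m) summable_on {0<..} \<times> {0<..}" by (rule abs_summable_summable)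
  qed
qed

text \<open>This says that the Mangoldt series is -L'/L. It is the identity
  \<open>mangoldt_sum\<close>, that \<Lambda> summed over the divisors of n gives ln n, twisted by
  the completely multiplicative \<psi>; the double series converges absolutely and may be regrouped
  by the product of its indices.\<close>

lemma dseries_mangoldt_times_dseries:
  assumes \<psi>: "dirichlet_char N \<psi>" and N: "N > 0" and s: "s > 1"
  shows "dseries_mangoldt \<psi> s * dseries \<psi> s = dseries_ln \<psi> s"
proof -
  define f where "f = (\<lambda>n. \<psi> n * of_real (mangoldt n * real n powr - s))"
  define g where "g = (\<lambda>n. \<psi> n * of_real (real n powr - s))"
  define h where "h = (\<lambda>n. \<psi> n * of_real (ln (real n) * real n powr - s))"
  note le = norm_dirichlet_char_le_1[OF \<psi> N]
  have "((\<lambda>(n, m). f n * g m) has_sum (\<Sum>n. f n) * (\<Sum>n. g n)) ({0<..} \<times> {0<..})"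
    by (rule has_sum_times)
       (use dseries_mangoldt_abs_summable[OF le s] dseries_abs_summable[OF le s] in \<open>auto simp: f_def g_def\<close>)
  from has_sum_divisors[OF this]
  have "((\<lambda>n. \<Sum>d | d dvd n. f d * g (n div d)) has_sum (\<Sum>n. f n) * (\<Sum>n. g n)) {0<..}" by simp
  also have "?this \<longleftrightarrow> (h has_sum (\<Sum>n. f n) * (\<Sum>n. g n)) UNIV"
  proof (rule has_sum_cong_neutral)
    fix n :: nat assume n: "n \<in> {0<..} \<inter> UNIV"
    have "f d * g (n div d) = \<psi> n * of_real (real n powr - s) * mangoldt d" if "d dvd n" for d
    proof -
      have "real d powr - s * real (n div d) powr - s = real n powr - s"
        using that by (simp add: powr_mult[symmetric] flip: of_nat_mult)
      moreover have "\<psi> d * \<psi> (n div d) = \<psi> n"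
        using that by (simp flip: dirichlet_charD(1)[OF \<psi>])
      moreover have "f d * g (n div d) = (\<psi> d * \<psi> (n div d)) * of_real (real d powr - s * real (n div d) powr - s) * mangoldt d"
        by (simp add: f_def g_def)
      ultimately show ?thesis by simp
    qed
    hence "(\<Sum>d | d dvd n. f d * g (n div d)) = \<psi> n * of_real (real n powr - s) * (\<Sum>d | d dvd n. mangoldt d)"
      by (simp add: sum_distrib_left)
    also have "\<dots> = h n" using n by (simp add: mangoldt_sum h_def)
    finally show "(\<Sum>d | d dvd n. f d * g (n div d)) = h n" .
  qed (auto simp: h_def)
  finally have "h sums ((\<Sum>n. f n) * (\<Sum>n. g n))" by (rule has_sum_imp_sums)
  thus ?thesis by (simp add: sums_iff dseries_mangoldt_def dseries_def dseries_ln_def f_def g_def h_def)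
qed

text \<open>Each divisor of \<open>a * b\<close> splits uniquely into a divisor of \<open>a\<close>
  and one of \<open>b\<close>, recovered by the two gcds.\<close>

lemma sum_divisors_coprime_mult:
  fixes f :: "nat \<Rightarrow> 'a :: comm_semiring_1"
  assumes f: "\<And>m n. f (m * n) = f m * f n" and "coprime a b"
  shows "(\<Sum>d | d dvd a * b. f d) = (\<Sum>d | d dvd a. f d) * (\<Sum>d | d dvd b. f d)"
proof -
  have "(\<Sum>d | d dvd a. f d) * (\<Sum>d | d dvd b. f d) = (\<Sum>(x, y) \<in> {d. d dvd a} \<times> {d. d dvd b}. f (x * y))"
    by (simp add: sum_product sum.cartesian_product f)
  also have "\<dots> = (\<Sum>d | d dvd a * b. f d)"
  proof -
    have "inj_on (\<lambda>(x, y). x * y) ({d. d dvd a} \<times> {d. d dvd b})"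
    proof (rule inj_on_inverseI[where g = "\<lambda>d. (gcd d a, gcd d b)"])
      fix p assume p: "p \<in> {d. d dvd a} \<times> {d. d dvd b}"
      obtain x y where [simp]: "p = (x, y)" by force
      have xy: "x dvd a" "y dvd b" using p by auto
      have "coprime x b" "coprime a y"
        using xy \<open>coprime a b\<close> by (meson coprime_divisors dvd_refl)+
      hence "gcd (x * y) a = x" "gcd (x * y) b = y"
        using xy by (simp_all add: gcd_mult_left_left_cancel gcd_mult_left_right_cancel coprime_commute gcd_proj1_iff)
      thus "(\<lambda>d. (gcd d a, gcd d b)) (case p of (x, y) \<Rightarrow> x * y) = p" by simp
    qed
    moreover have "(\<lambda>(x, y). x * y) ` ({d. d dvd a} \<times> {d. d dvd b}) = {d. d dvd a * b}"
    proof (intro equalityI subsetI)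
      fix d assume "d \<in> {d. d dvd a * b}"
      then obtain x y where "d = x * y" "x dvd a" "y dvd b"
        using division_decomp[of d a b] by blast
      thus "d \<in> (\<lambda>(x, y). x * y) ` ({d. d dvd a} \<times> {d. d dvd b})" by force
    qed (auto intro: mult_dvd_mono)
    ultimately have "bij_betw (\<lambda>(x, y). x * y) ({d. d dvd a} \<times> {d. d dvd b}) {d. d dvd a * b}"
      by (simp add: bij_betw_def)
    from sum.reindex_bij_betw[OF this, of f] show ?thesis by (simp add: case_prod_unfold)
  qed
  finally show ?thesis by simp
qed

text \<open>Multiplicativity reduces this to prime powers p^e. There \<open>r p\<close> is 0, 1 or
  -1, and the sum is 1, e + 1, or alternately 1 and 0.\<close>

lemma sum_dirichlet_char_divisors_nonneg:
  assumes \<psi>: "dirichlet_char N \<psi>" and real: "\<And>n. \<psi> n = of_real (r n)" and N: "N > 0" and "n > 0"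
  shows "(\<Sum>d | d dvd n. r d) \<ge> 0"
  using \<open>n > 0\<close>
proof (induction n rule: less_induct)
  case (less n)
  have mult: "r (x * y) = r x * r y" for x y
    using dirichlet_charD(1)[OF \<psi>, of x y] unfolding real by (metis of_real_eq_iff of_real_mult)
  have r1: "r 1 = 1" using dirichlet_char_1[OF \<psi>] real[of 1] by simp
  show ?case
  proof (cases "n = 1")
    case False
    then obtain p where p: "prime p" "p dvd n" using prime_factor_nat by blast
    define e where "e = multiplicity p n"
    obtain m where m: "n = p ^ e * m" "\<not> p dvd m"
      using multiplicity_decompose'[of n p] less.prems p not_prime_1 by (metis e_def less_numeral_extra(3) not_prime_unit)
    have m0: "m > 0" using m(1) less.prems by (cases "m = 0") auto
    have "e > 0" using p less.prems by (simp add: e_def prime_multiplicity_gt_zero_iff)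
    hence "p ^ e > 1" using prime_gt_1_nat[OF p(1)] by (intro one_less_power)
    hence "m < n" using m(1) m0 by simp
    hence IH: "(\<Sum>d | d dvd m. r d) \<ge> 0" using less.IH m0 by blast
    have rp: "r p = 0 \<or> r p = 1 \<or> r p = -1"
      using norm_dirichlet_char[OF \<psi> _ N, of p] dirichlet_charD(3)[OF \<psi>, of p] unfolding real by auto
    have "(\<Sum>d | d dvd p ^ e. r d) = (\<Sum>i\<le>e. r (p ^ i))"
    proof (rule sum.reindex_bij_betw[symmetric])
      show "bij_betw ((^) p) {..e} {d. d dvd p ^ e}"
        using prime_gt_1_nat[OF p(1)] divides_primepow_nat[OF p(1)] 
        by (auto simp: bij_betw_def inj_on_def)
    qed
    also have "\<dots> = (\<Sum>i\<le>e. r p ^ i)"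
    proof -
      have "r (p ^ i) = r p ^ i" for i by (induction i) (simp_all add: mult r1[simplified])
      thus ?thesis by simp
    qed
    also have "\<dots> \<ge> 0"
    proof -
      have "(\<Sum>i\<le>e. (-1::real) ^ i) \<ge> 0 \<and> (\<Sum>i\<le>e. (-1::real) ^ i) = (if even e then 1 else 0)" by (induction e) auto
      thus ?thesis using rp by (auto simp: power_0_left)
    qed
    finally have "(\<Sum>d | d dvd p ^ e. r d) \<ge> 0" .
    moreover have "coprime (p ^ e) m" using m(2) p(1) by (simp add: prime_imp_coprime)
    ultimately show ?thesis using IH m(1) by (simp add: sum_divisors_coprime_mult mult)
  qed (simp add: r1[simplified])
qed

section \<open>Non-vanishing at 1\<close>

text \<open>The arithmetic mean of 1, t^2, ..., t^(2n) is at least their geometric mean t^n;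
  multiplying by 1 - t^2 closes the geometric sum.\<close>

lemma mult_power_le_geometric:
  fixes t :: real
  assumes t: "0 \<le> t" "t \<le> 1"
  shows "real (Suc n) * t ^ n * (1 - t\<^sup>2) \<le> 1 - t ^ (2 * Suc n)"
proof (induction n)
  case (Suc n)
  have "1 + real (n + 2) * (t - 1) \<le> (1 + (t - 1)) ^ (n + 2)"
    using t by (intro Bernoulli_inequality) auto
  hence "real (n + 2) * t \<le> real (Suc n) + t ^ (n + 2)" by (simp add: algebra_simps)
  hence *: "t ^ n * (real (n + 2) * t) \<le> t ^ n * (real (Suc n) + t ^ (n + 2))"
    using t by (intro mult_left_mono) auto
  have "real (n + 2) * t ^ Suc n \<le> real (Suc n) * t ^ n + t ^ (2 * Suc n)"
  proof -
    have "t ^ n * t ^ (n + 2) = t ^ (2 * Suc n)"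
      by (subst power_add[symmetric]) (rule arg_cong[of _ _ "(^) t"], simp)
    thus ?thesis using * by (simp only: distrib_left) (simp add: mult_ac)
  qed
  moreover have "0 \<le> 1 - t\<^sup>2" using t by (simp add: power_le_one)
  ultimately have "real (n + 2) * t ^ Suc n * (1 - t\<^sup>2) \<le> (real (Suc n) * t ^ n + t ^ (2 * Suc n)) * (1 - t\<^sup>2)"
    by (rule mult_right_mono)
  also have "\<dots> \<le> 1 - t ^ (2 * Suc n) + t ^ (2 * Suc n) * (1 - t\<^sup>2)"
    using Suc by (simp add: distrib_right)
  also have "\<dots> = 1 - t ^ (2 * Suc (Suc n))" by (simp add: algebra_simps power2_eq_square)
  finally show ?case by simp
qed simp

text \<open>The claim reduces to n (n + 1) (1 - x)^2 x^n <= (1 - x^n) (1 - x^(n+1)). With t the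
  square root of x, the product of the mean inequalities for n and n + 1 gives this with t^(2n-1) in
  place of x^n = t^(2n), which is stronger.\<close>

lemma lambert_term_decreasing:
  fixes x :: real
  assumes x: "0 < x" "x < 1" and n: "n > 0"
  shows "1 / (real (Suc n) * (1 - x)) - x ^ Suc n / (1 - x ^ Suc n) \<le> 1 / (real n * (1 - x)) - x ^ n / (1 - x ^ n)"
proof -
  define t where "t = sqrt x"
  have t: "0 \<le> t" "t \<le> 1" "t\<^sup>2 = x" using x by (auto simp: t_def real_le_lsqrt)
  obtain k where k: "n = Suc k" using n by (cases n) auto
  have 1: "real n * t ^ k * (1 - x) \<le> 1 - x ^ n"
    using mult_power_le_geometric[OF t(1,2), of k] by (simp only: power_mult t(3) k)
  have 2: "real (Suc n) * t ^ n * (1 - x) \<le> 1 - x ^ Suc n"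
    using mult_power_le_geometric[OF t(1,2), of n] by (simp only: power_mult t(3))
  have "(real n * t ^ k * (1 - x)) * (real (Suc n) * t ^ n * (1 - x)) \<le> (1 - x ^ n) * (1 - x ^ Suc n)"
    using 1 2 t x by (intro mult_mono) (auto simp: power_le_one)
  moreover have "x ^ n \<le> t ^ k * t ^ n"
  proof -
    have "x ^ n = t ^ n * t ^ n" using t(3) by (metis power_mult_distrib power2_eq_square)
    also have "\<dots> \<le> t ^ k * t ^ n" using t by (intro mult_right_mono) (auto simp: k intro: mult_left_le_one_le)
    finally show ?thesis .
  qed
  hence "(real n * real (Suc n) * (1 - x)\<^sup>2) * x ^ n \<le> (real n * real (Suc n) * (1 - x)\<^sup>2) * (t ^ k * t ^ n)"
    by (intro mult_left_mono) auto
  ultimately have main: "real n * real (Suc n) * (1 - x)\<^sup>2 * x ^ n \<le> (1 - x ^ n) * (1 - x ^ Suc n)"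
    by (simp add: power2_eq_square mult_ac)
  have pos: "1 - x ^ n > 0" "1 - x ^ Suc n > 0" "1 - x > 0" "real n > 0" "real (Suc n) > 0"
    using x n power_less_one_iff[of x] by (auto simp del: power_Suc)
  have "x ^ n / (1 - x ^ n) - x ^ Suc n / (1 - x ^ Suc n) = x ^ n * (1 - x) / ((1 - x ^ n) * (1 - x ^ Suc n))"
    using pos by (simp add: field_simps)
  also have "\<dots> \<le> 1 / (real n * real (Suc n) * (1 - x))"
  proof -
    have "x ^ n * (1 - x) * (real n * real (Suc n) * (1 - x)) \<le> 1 * ((1 - x ^ n) * (1 - x ^ Suc n))"
      using main by (simp add: power2_eq_square mult_ac)
    thus ?thesis using pos by (subst frac_le_eq) (auto simp: divide_le_0_iff)
  qed
  also have "\<dots> = 1 / (real n * (1 - x)) - 1 / (real (Suc n) * (1 - x))"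
  proof -
    have "1 / real n - 1 / real (Suc n) = 1 / (real n * real (Suc n))"
      using n by (simp add: field_simps)
    hence "(1 / real n - 1 / real (Suc n)) / (1 - x) = 1 / (real n * real (Suc n)) / (1 - x)"
      by (rule arg_cong)
    thus ?thesis by (simp only: diff_divide_distrib divide_divide_eq_left)
  qed
  finally show ?thesis by simp
qed

text \<open>Expanding x^n / (1 - x^n) as the sum of x^(n m) over m >= 1 and collecting equal
  products n m turns the Lambert series into a power series.\<close>

lemma has_sum_lambert:
  fixes x :: real and r :: "nat \<Rightarrow> real"
  assumes x: "0 < x" "x < 1" and r: "\<And>n. \<bar>r n\<bar> \<le> 1"
  shows "summable (\<lambda>n. r n * (x ^ n / (1 - x ^ n)))"
    and "((\<lambda>n. (\<Sum>d | d dvd n. r d) * x ^ n) has_sum (\<Sum>n. r n * (x ^ n / (1 - x ^ n)))) {0<..}"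
proof -
  define h where "h = (\<lambda>n. r n * (x ^ n / (1 - x ^ n)))"
  have le: "\<bar>h n\<bar> \<le> x ^ n / (1 - x ^ n)" "x ^ n / (1 - x ^ n) \<le> x ^ n / (1 - x)" if "n > 0" for n
  proof -
    have "x ^ n \<le> x" using power_decreasing[of 1 n x] x that by simp
    moreover have "\<bar>h n\<bar> = \<bar>r n\<bar> * (x ^ n / (1 - x ^ n))" using x by (simp add: h_def abs_mult power_le_one)
    moreover have "\<bar>r n\<bar> * (x ^ n / (1 - x ^ n)) \<le> 1 * (x ^ n / (1 - x ^ n))"
      using r[of n] x by (intro mult_right_mono) (auto simp: power_le_one)
    ultimately show "\<bar>h n\<bar> \<le> x ^ n / (1 - x ^ n)" "x ^ n / (1 - x ^ n) \<le> x ^ n / (1 - x)"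
      using x by (auto intro!: divide_left_mono)
  qed
  have sm: "summable (\<lambda>n. x ^ n / (1 - x))" using x by (intro summable_divide summable_geometric) auto
  have sh: "summable (\<lambda>n. norm (h n))"
    using sm
  proof (rule summable_comparison_test'[where N = 1])
    fix n :: nat assume "n \<ge> 1"
    thus "norm (norm (h n)) \<le> x ^ n / (1 - x)" using le[of n] by simp
  qed
  thus "summable (\<lambda>n. r n * (x ^ n / (1 - x ^ n)))" unfolding h_def by (rule summable_norm_cancel)
  have "(h has_sum (\<Sum>n. h n)) UNIV"
    by (rule norm_summable_imp_has_sum[OF sh summable_sums[OF summable_norm_cancel[OF sh]]])
  hence H: "(h has_sum (\<Sum>n. h n)) {0<..}"
    by (rule has_sum_cong_neutral[THEN iffD1, rotated -1]) (auto simp: h_def)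
  have "(\<lambda>n. x ^ n / (1 - x)) summable_on UNIV"
    using sm x by (subst summable_on_UNIV_nonneg_real_iff) auto
  hence G: "(\<lambda>n. x ^ n / (1 - x)) summable_on {0<..}" by (rule summable_on_subset_banach) simp
  have geo: "((\<lambda>m. x ^ (n * m)) has_sum x ^ n / (1 - x ^ n)) {0<..}" if "n > 0" for n
  proof -
    have xn: "\<bar>x ^ n\<bar> < 1" using x that by (simp add: power_less_one_iff)
    have "(\<lambda>m. (x ^ n) ^ m) sums (1 / (1 - x ^ n))" by (rule geometric_sums) (use xn in simp)
    hence "((\<lambda>m. (x ^ n) ^ m) has_sum (1 / (1 - x ^ n))) UNIV"
      by (rule sums_nonneg_imp_has_sum) (use x in auto)
    hence "((\<lambda>m. x ^ n * (x ^ n) ^ m) has_sum (x ^ n * (1 / (1 - x ^ n)))) UNIV"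
      by (rule has_sum_cmult_right)
    hence "((\<lambda>m. x ^ (n * Suc m)) has_sum (x ^ n / (1 - x ^ n))) UNIV"
      by (simp add: power_add power_mult)
    moreover have "bij_betw Suc UNIV {0<..}"
      by (rule bij_betw_byWitness[where f' = "\<lambda>n. n - 1"]) auto
    ultimately show ?thesis using has_sum_reindex_bij_betw[of Suc UNIV "{0<..}" "\<lambda>m. x ^ (n * m)"] by simp
  qed
  have "((\<lambda>(n, m). r n * x ^ (n * m)) has_sum (\<Sum>n. h n)) ({0<..} \<times> {0<..})"
  proof (rule has_sum_SigmaI[OF _ H])
    show "((\<lambda>m. case (n, m) of (n, m) \<Rightarrow> r n * x ^ (n * m)) has_sum h n) {0<..}" if "n \<in> {0<..}" for n
      using has_sum_cmult_right[OF geo[of n], of "r n"] that by (simp add: h_def)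
    have P: "(\<lambda>(n, m). x ^ (n * m)) summable_on {0<..} \<times> {0<..}"
    proof (rule summable_on_SigmaI)
      show "((\<lambda>m. case (n, m) of (n, m) \<Rightarrow> x ^ (n * m)) has_sum x ^ n / (1 - x ^ n)) {0<..}" if "n \<in> {0<..}" for n
        using geo[of n] that by simp
      show "(\<lambda>n. x ^ n / (1 - x ^ n)) summable_on {0<..}"
        using G by (rule summable_on_comparison_test) (use le x in \<open>auto simp: power_le_one\<close>)
    qed (use x in auto)
    have "norm (case p of (n, m) \<Rightarrow> r n * x ^ (n * m)) \<le> (case p of (n, m) \<Rightarrow> x ^ (n * m))" for p
      using r x by (cases p) (simp add: abs_mult mult_left_le_one_le)
    hence "(\<lambda>p. norm (case p of (n, m) \<Rightarrow> r n * x ^ (n * m))) summable_on {0<..} \<times> {0<..}"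
      by (intro summable_on_comparison_test[OF P]) auto
    thus "(\<lambda>(n, m). r n * x ^ (n * m)) summable_on {0<..} \<times> {0<..}"
      by (rule abs_summable_summable)
  qed
  from has_sum_divisors[OF this]
  show "((\<lambda>n. (\<Sum>d | d dvd n. r d) * x ^ n) has_sum (\<Sum>n. r n * (x ^ n / (1 - x ^ n)))) {0<..}"
    unfolding h_def by (rule has_sum_cong[THEN iffD1, rotated]) (simp add: sum_distrib_right)
qed

text \<open>Monsky's argument: if the series vanished at 1, then the Lambert series
  $\<Sum> r(n) x^n / (1 - x^n)$ could be compared with $\<Sum> r(n) / (n (1 - x)) = 0$, and it would be bounded on
  $(0, 1)$ by partial summation, since the differences of the weights decrease. But its power series
  coefficients are nonnegative, and equal to 1 at the powers of $N$.\<close>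

lemma dseries_real_char_nonzero:
  assumes \<psi>: "dirichlet_char N \<psi>" "\<psi> \<noteq> principal_char N" and real: "\<And>n. \<psi> n = of_real (r n)" and N: "N > 1"
  shows "dseries \<psi> 1 \<noteq> 0"
proof
  assume zero: "dseries \<psi> 1 = 0"
  have N0: "N > 0" using N by simp
  have r_le: "\<bar>r n\<bar> \<le> 1" for n using norm_dirichlet_char_le_1[OF \<psi>(1) N0, of n] real[of n] by simp
  define c where "c = (\<lambda>n. \<Sum>d | d dvd n. r d)"
  have c_nn: "c n \<ge> 0" if "n > 0" for n
    unfolding c_def by (rule sum_dirichlet_char_divisors_nonneg[OF \<psi>(1) real N0 that])
  \<comment> \<open>A divisor of a power of \<open>N\<close> other than 1 shares a factor with
    \<open>N\<close>, so the character vanishes there and only the divisor 1 counts.\<close>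
  have c_pow: "c (N ^ k) = 1" for k
  proof -
    have "r d = 0" if "d dvd N ^ k" "d \<noteq> 1" for d
    proof -
      have "\<not> coprime d N"
        using that by (metis coprime_absorb_left coprime_power_right_iff is_unit_gcd not_coprimeI nat_dvd_1_iff_1 power_0 coprime_common_divisor dvd_refl)
      thus ?thesis using dirichlet_charD(3)[OF \<psi>(1), of d] real[of d] by simp
    qed
    moreover have "r 1 = 1" using dirichlet_char_1[OF \<psi>(1)] real[of 1] by simp
    ultimately have "(\<Sum>d | d dvd N ^ k. r d) = (\<Sum>d | d dvd N ^ k. if d = 1 then 1 else 0)"
      by (intro sum.cong) auto
    thus ?thesis using N by (simp add: c_def sum.If_cases)
  qed
  have bound: "(\<Sum>k<K. x ^ (N ^ k)) \<le> 2 * real N" if x: "0 < x" "x < 1" for x :: real and K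
  proof -
    define b where "b = (\<lambda>n. 1 / (real n * (1 - x)) - x ^ n / (1 - x ^ n))"
    define S where "S = (\<Sum>n. r n * (x ^ n / (1 - x ^ n)))"
    note lam = has_sum_lambert[OF x r_le]
    have b_lim: "b \<longlonglongrightarrow> 0"
    proof -
      have "(\<lambda>n. x ^ n) \<longlonglongrightarrow> 0" using x by (intro LIMSEQ_power_zero) auto
      hence "(\<lambda>n. x ^ n / (1 - x ^ n)) \<longlonglongrightarrow> 0 / (1 - 0)"
        by (intro tendsto_divide tendsto_diff tendsto_const) auto
      moreover have "(\<lambda>n. 1 / real n * (1 / (1 - x))) \<longlonglongrightarrow> 0 * (1 / (1 - x))"
        by (intro tendsto_intros lim_1_over_n)
      ultimately have "(\<lambda>n. 1 / real n * (1 / (1 - x)) - x ^ n / (1 - x ^ n)) \<longlonglongrightarrow> 0 - 0"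
        by (intro tendsto_diff) auto
      thus ?thesis by (simp add: b_def)
    qed
    have b_dec: "b (Suc n) \<le> b n" if "n \<ge> 1" for n
      unfolding b_def using lambert_term_decreasing[OF x] that by simp
    have "norm ((\<Sum>k<1. \<psi> k * of_real (b k)) - (\<Sum>k. \<psi> k * of_real (b k))) \<le> 2 * real N * b 1"
      using norm_sum_dirichlet_char_le[OF \<psi> N0] b_dec b_lim
      by (intro dirichlet_test_tail[where m = 1]) auto
    \<comment> \<open>1/(1 - x) - x/(1 - x) = 1 for every \<open>x\<close>: this makes the bound
      uniform as \<open>x\<close> tends to 1.\<close>
    moreover have "b 1 = 1" using x by (simp add: b_def field_simps)
    \<comment> \<open>Both fractions have denominator 0 and thus value 0.\<close>
    moreover have "b 0 = 0" by (simp add: b_def)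
    ultimately have bd: "norm (\<Sum>k. \<psi> k * of_real (b k)) \<le> 2 * real N" by simp
    have "(\<lambda>n. \<psi> n * of_real (real n powr -1)) sums 0"
      using bounded_sums_dseries_summable[OF norm_sum_dirichlet_char_le[OF \<psi> N0], of 1] zero
      by (simp add: sums_iff dseries_def)
    hence "(\<lambda>n. \<psi> n * of_real (real n powr -1) * of_real (1 / (1 - x))) sums (0 * of_real (1 / (1 - x)))"
      by (rule sums_mult2)
    moreover have "(\<lambda>n. of_real (r n * (x ^ n / (1 - x ^ n))) :: complex) sums of_real S"
      unfolding S_def by (rule sums_of_real[OF summable_sums[OF lam(1)]])
    ultimately have "(\<lambda>n. \<psi> n * of_real (real n powr -1) * of_real (1 / (1 - x))
        - of_real (r n * (x ^ n / (1 - x ^ n)))) sums (0 * of_real (1 / (1 - x)) - of_real S)"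
      by (rule sums_diff)
    moreover have "\<psi> n * of_real (real n powr -1) * of_real (1 / (1 - x))
        - of_real (r n * (x ^ n / (1 - x ^ n))) = \<psi> n * of_real (b n)" for n
      by (cases "n = 0") (simp_all add: real b_def powr_minus field_simps)
    ultimately have "(\<Sum>k. \<psi> k * of_real (b k)) = - of_real S" by (simp add: sums_iff)
    hence "S \<le> 2 * real N" using bd by simp
    moreover have "(\<Sum>k<K. x ^ (N ^ k)) \<le> S"
    proof -
      have inj: "inj_on (\<lambda>k. N ^ k) {..<K}" using N by (auto simp: inj_on_def)
      have "(\<Sum>k<K. x ^ (N ^ k)) = (\<Sum>k<K. c (N ^ k) * x ^ (N ^ k))" by (simp add: c_pow)
      also have "\<dots> = (\<Sum>n\<in>(\<lambda>k. N ^ k) ` {..<K}. c n * x ^ n)"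
        by (simp add: sum.reindex[OF inj] o_def)
      also have "\<dots> \<le> S"
      proof (rule has_sum_mono_neutral)
        show "((\<lambda>n. c n * x ^ n) has_sum (\<Sum>n\<in>(\<lambda>k. N ^ k) ` {..<K}. c n * x ^ n)) ((\<lambda>k. N ^ k) ` {..<K})"
          by (rule has_sum_finite) simp
        show "((\<lambda>n. c n * x ^ n) has_sum S) {0<..}" using lam(2) by (simp add: c_def S_def)
      qed (use c_nn x N in auto)
      finally show ?thesis .
    qed
    ultimately show ?thesis by simp
  qed
  \<comment> \<open>As \<open>x\<close> tends to 1, the sum of \<open>K\<close> terms tends to
    \<open>K\<close>, which must exceed \<open>2 * N\<close>.\<close>
  define K where "K = Suc (2 * N)"
  have "((\<lambda>x. \<Sum>k<K. x ^ (N ^ k)) \<longlongrightarrow> (\<Sum>k<K. 1 ^ (N ^ k))) (at_left (1::real))"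
    by (intro tendsto_intros)
  moreover have "eventually (\<lambda>x. (\<Sum>k<K. x ^ (N ^ k)) \<le> 2 * real N) (at_left (1::real))"
    unfolding eventually_at_left_field by (rule exI[of _ 0]) (use bound in auto)
  ultimately have "(\<Sum>k<K. 1 ^ (N ^ k)) \<le> 2 * real N"
    by (rule tendsto_upperbound) simp
  thus False by (simp add: K_def)
qed

section \<open>Bounds near 1 and the nonreal characters\<close>

lemma dseries_cnj: "dseries (\<lambda>n. cnj (f n)) s = cnj (dseries f s)" if "summable (\<lambda>n. f n * of_real (real n powr - s))"
proof -
  have "(\<lambda>n. cnj (f n * of_real (real n powr - s))) sums cnj (\<Sum>n. f n * of_real (real n powr - s))"
    using summable_sums[OF that] by (simp only: sums_cnj)
  thus ?thesis by (simp add: dseries_def sums_iff)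
qed

text \<open>The right-hand side is the integral of x^(-1-t) from n to n + 1, which is at least its
  integrand at the right end. With u = 1/(n + 1), the inequality becomes 1 + t u <= (1 -
  u)^(-t).\<close>

lemma powr_le_telescope:
  assumes t: "t > 0" and n: "n \<ge> 1"
  shows "real (Suc n) powr - (1 + t) \<le> (real n powr - t - real (Suc n) powr - t) / t"
proof -
  define u where "u = 1 / real (Suc n)"
  have u: "0 < u" "u < 1" using n by (auto simp: u_def)
  have "real n = real (Suc n) * (1 - u)" by (simp add: u_def field_simps)
  hence "real n powr - t = (real (Suc n) * (1 - u)) powr - t" by simp
  hence "real n powr - t = real (Suc n) powr - t * (1 - u) powr - t"
    using u by (subst (asm) powr_mult) auto
  moreover have "1 + t * u \<le> (1 - u) powr - t"
  proof -
    have "ln (1 - u) \<le> - u" using ln_add_one_self_le_self2[of "- u"] u by simp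
    hence "t * ln (1 - u) \<le> t * - u" using t by (intro mult_left_mono) auto
    hence "t * u \<le> - t * ln (1 - u)" by simp
    hence "exp (t * u) \<le> (1 - u) powr - t" using u by (simp add: powr_def)
    thus ?thesis using exp_ge_add_one_self[of "t * u"] by linarith
  qed
  ultimately have "real (Suc n) powr - t * (1 + t * u) \<le> real n powr - t"
    by (simp add: mult_left_mono)
  moreover have "real (Suc n) powr - (1 + t) = real (Suc n) powr - t * u"
  proof -
    have "- (1 + t) = - t - 1" by simp
    thus ?thesis using powr_diff[of "real (Suc n)" "- t" 1] by (simp only:) (simp add: u_def)
  qed
  ultimately show ?thesis using t by (simp add: pos_le_divide_eq algebra_simps)
qed

text \<open>Comparison with the zeta series: the growth towards 1 is at most that of a simple
  pole.\<close>

lemma norm_dseries_le: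
  assumes f: "\<And>n. norm (f n) \<le> 1" and s: "s > 1"
  shows "norm (dseries f s) \<le> 1 + 1 / (s - 1)"
proof -
  define t where "t = s - 1"
  have t: "t > 0" "s = 1 + t" using s by (auto simp: t_def)
  note sm = dseries_abs_summable[OF f s]
  have "norm (dseries f s) \<le> (\<Sum>n. norm (f n * of_real (real n powr - s)))"
    unfolding dseries_def using sm by (rule summable_norm)
  also have "\<dots> \<le> 1 + 1 / t"
  proof (rule suminf_le_const[OF sm])
    fix n
    have "(\<Sum>i<n. norm (f i * of_real (real i powr - s))) \<le> (\<Sum>i<n. real i powr - s)"
    proof (rule sum_mono)
      fix i show "norm (f i * of_real (real i powr - s)) \<le> real i powr - s"
        using f[of i] by (simp add: norm_mult mult_left_le_one_le)
    qed
    also have "\<dots> \<le> (\<Sum>i<Suc (Suc n). real i powr - s)" by (intro sum_mono2) auto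
    also have "\<dots> \<le> 1 + (1 - real (Suc n) powr - t) / t"
    proof (induction n)
      case (Suc n)
      have "(\<Sum>i<Suc (Suc (Suc n)). real i powr - s) \<le> 1 + (1 - real (Suc n) powr - t) / t + real (Suc (Suc n)) powr - s"
        using Suc by simp
      also have "real (Suc (Suc n)) powr - s \<le> (real (Suc n) powr - t - real (Suc (Suc n)) powr - t) / t"
        using powr_le_telescope[OF t(1), of "Suc n"] by (simp only: t(2))
      also have "1 + (1 - real (Suc n) powr - t) / t + (real (Suc n) powr - t - real (Suc (Suc n)) powr - t) / t
        = 1 + (1 - real (Suc (Suc n)) powr - t) / t" by (simp add: diff_divide_distrib)
      finally show ?case by simp
    qed simp
    also have "\<dots> \<le> 1 + 1 / t" using t by (simp add: divide_right_mono)
    finally show "(\<Sum>i<n. norm (f i * of_real (real i powr - s))) \<le> 1 + 1 / t" .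
  qed
  finally show ?thesis by (simp add: t_def)
qed

text \<open>The term at 1 dominates: the others sum to at most 1/2, since 2 (n + 1) (n + 2) <= (n +
  2)^3 allows a telescoping comparison. The point 3 is the anchor from which the product of all
  series is bounded below.\<close>

lemma dseries_nonzero_at_3:
  assumes f: "\<And>n. norm (f n) \<le> 1" and f1: "f (Suc 0) = 1"
  shows "dseries f 3 \<noteq> 0"
proof
  assume "dseries f 3 = 0"
  note sm = dseries_abs_summable[OF f, of 3]
  have "dseries f 3 = (\<Sum>n. f (n + 2) * of_real (real (n + 2) powr - 3)) + (\<Sum>n<2. f n * of_real (real n powr - 3))"
    unfolding dseries_def by (rule suminf_split_initial_segment[OF summable_norm_cancel[OF sm]]) simp
  also have "(\<Sum>n<2. f n * of_real (real n powr - 3)) = 1" by (simp add: numeral_2_eq_2 f1)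
  finally have "(\<Sum>n. f (n + 2) * of_real (real (n + 2) powr - 3)) = - 1"
    using \<open>dseries f 3 = 0\<close> by (simp add: eq_neg_iff_add_eq_0)
  moreover have "norm (\<Sum>n. f (n + 2) * of_real (real (n + 2) powr - 3)) \<le> 1 / 2"
  proof -
    have "(\<lambda>n. 1 / real (n + 1)) \<longlonglongrightarrow> 0" by real_asymp
    from telescope_sums'[OF this]
    have "(\<lambda>n. 1 / real (n + 1) - 1 / real (n + 2)) sums 1" by (simp add: add.commute)
    hence half: "(\<lambda>n. (1 / real (n + 1) - 1 / real (n + 2)) / 2) sums (1 / 2)" by (rule sums_divide)
    have "norm (f (n + 2) * of_real (real (n + 2) powr - 3)) \<le> (1 / real (n + 1) - 1 / real (n + 2)) / 2" for n
    proof -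
      have "norm (f (n + 2) * of_real (real (n + 2) powr - 3)) \<le> real (n + 2) powr - 3"
        using f[of "n + 2"] by (simp add: norm_mult mult_left_le_one_le)
      also have "real (n + 2) powr - 3 = 1 / real (n + 2) ^ 3"
        by (simp add: powr_minus divide_inverse powr_numeral)
      also have "\<dots> \<le> (1 / real (n + 1) - 1 / real (n + 2)) / 2"
      proof -
        have "2 * (real (n + 1) * real (n + 2)) \<le> real (n + 2) ^ 3"
          by (simp add: algebra_simps power3_eq_cube)
        hence "1 / real (n + 2) ^ 3 \<le> 1 / (2 * (real (n + 1) * real (n + 2)))"
          by (intro divide_left_mono) auto
        also have "\<dots> = (1 / real (n + 1) - 1 / real (n + 2)) / 2"
          by (simp add: field_simps)
        finally show ?thesis .
      qed
      finally show ?thesis .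
    qed
    from norm_suminf_le[OF this sums_summable[OF half]] show ?thesis using half by (simp add: sums_iff)
  qed
  ultimately show False by simp
qed

text \<open>A bounded derivative controls the series near 1 in both cases: a zero at 1 makes it at
  most \<open>B * (s - 1)\<close>, and a nonzero value at 1 keeps it away from 0.\<close>

lemma dseries_nonprincipal_lipschitz:
  assumes \<psi>: "dirichlet_char N \<psi>" "\<psi> \<noteq> principal_char N" and N: "N > 0"
  obtains B where "B > 0" "\<And>s. s \<ge> 1 \<Longrightarrow> norm (dseries_ln \<psi> s) \<le> B"
    "\<And>s. s \<ge> 1 \<Longrightarrow> norm (dseries \<psi> s - dseries \<psi> 1) \<le> B * (s - 1)"
proof -
  define B where "B = norm (\<psi> 2) * ln 2 + 2 * real N * ln 3"
  have "2 * real N * ln 3 > 0" using N by simp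
  moreover have "norm (\<psi> 2) * ln 2 \<ge> 0" by simp
  ultimately have B0: "B > 0" unfolding B_def by linarith
  have le: "norm (dseries_ln \<psi> s) \<le> B" if "s \<ge> 1" for s
    unfolding B_def by (rule bounded_sums_dseries_ln_bound[OF norm_sum_dirichlet_char_le[OF \<psi> N] that])
  moreover have "norm (dseries \<psi> s - dseries \<psi> 1) \<le> B * (s - 1)" if s: "s \<ge> 1" for s
  proof -
    have "norm (dseries \<psi> s - dseries \<psi> 1) \<le> B * norm (s - 1)"
    proof (rule differentiable_bound[where S = "{1..}"])
      fix x :: real assume x: "x \<in> {1..}"
      show "(dseries \<psi> has_derivative (\<lambda>h. h *\<^sub>R - dseries_ln \<psi> x)) (at x within {1..})"
        using bounded_sums_dseries_deriv[OF norm_sum_dirichlet_char_le[OF \<psi> N], of x] x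
        by (simp add: has_vector_derivative_def)
      show "onorm (\<lambda>h. h *\<^sub>R - dseries_ln \<psi> x) \<le> B"
        using le[of x] x by (intro onorm_le) (simp add: mult.commute[of B] mult_left_mono)
    qed (use s in auto)
    thus ?thesis using s by simp
  qed
  ultimately show ?thesis using that B0 by blast
qed

text \<open>Weighting by \<open>\<psi> a\<close> selects the inverse class of \<open>a\<close>; when
  \<open>a\<close> is inverse to \<open>b\<close>, these are the n congruent to \<open>b\<close>.
  With \<open>a = 1\<close> the sum is real and nonnegative.\<close>

lemma sum_dseries_mangoldt:
  fixes N a :: nat and s :: real
  assumes N: "N > 1" and s: "s > 1"
  defines "g \<equiv> (\<lambda>n. if [a * n = 1] (mod N) then mangoldt n * real n powr - s else 0)"
  shows "summable g"
    and "(\<Sum>\<psi> | dirichlet_char N \<psi>. \<psi> a * dseries_mangoldt \<psi> s) =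
      of_real (real (card {\<psi>. dirichlet_char N \<psi>}) * (\<Sum>n. g n))"
proof -
  have N0: "N > 0" using N by simp
  have fin: "finite {\<psi>. dirichlet_char N \<psi>}" by (rule finite_dirichlet_char[OF N0])
  have "summable (\<lambda>n. norm (1 * of_real (mangoldt n * real n powr - s) :: complex))"
    by (rule dseries_mangoldt_abs_summable) (use s in auto)
  hence sm1: "summable (\<lambda>n. mangoldt n * real n powr - s)"
    by (simp add: norm_mult)
  show sm: "summable g"
    using sm1 by (rule summable_comparison_test'[where N = 0]) (auto simp: g_def mangoldt_nonneg)
  have sm': "summable (\<lambda>n. \<psi> n * of_real (mangoldt n * real n powr - s))" if "dirichlet_char N \<psi>" for \<psi>
    by (rule summable_norm_cancel[OF dseries_mangoldt_abs_summable[OF norm_dirichlet_char_le_1[OF that N0] s]])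
  have "(\<lambda>n. \<Sum>\<psi> | dirichlet_char N \<psi>. \<psi> a * (\<psi> n * of_real (mangoldt n * real n powr - s)))
     sums (\<Sum>\<psi> | dirichlet_char N \<psi>. \<psi> a * dseries_mangoldt \<psi> s)"
    unfolding dseries_mangoldt_def
    by (intro sums_sum sums_mult summable_sums sm') simp
  moreover have "(\<Sum>\<psi> | dirichlet_char N \<psi>. \<psi> a * (\<psi> n * of_real (mangoldt n * real n powr - s)))
     = of_real (real (card {\<psi>. dirichlet_char N \<psi>}) * g n)" for n
  proof -
    have "(\<Sum>\<psi> | dirichlet_char N \<psi>. \<psi> a * (\<psi> n * of_real (mangoldt n * real n powr - s)))
        = (\<Sum>\<psi> | dirichlet_char N \<psi>. \<psi> (a * n)) * of_real (mangoldt n * real n powr - s)"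
      unfolding sum_distrib_right by (intro sum.cong) (auto simp: dirichlet_charD(1))
    thus ?thesis unfolding sum_characters[OF N] by (simp add: g_def)
  qed
  moreover have "(\<lambda>n. of_real (real (card {\<psi>. dirichlet_char N \<psi>}) * g n) :: complex) sums
      of_real (real (card {\<psi>. dirichlet_char N \<psi>}) * (\<Sum>n. g n))"
    by (intro sums_of_real sums_mult summable_sums sm)
  ultimately show "(\<Sum>\<psi> | dirichlet_char N \<psi>. \<psi> a * dseries_mangoldt \<psi> s) =
      of_real (real (card {\<psi>. dirichlet_char N \<psi>}) * (\<Sum>n. g n))"
    by (metis (no_types, lifting) sums_cong sums_unique2)
qed

text \<open>The product $P$ of all series satisfies $P' = - T P$, where $T = \<Sum>_\<psi> \<Sum>_n \<psi>(n) \<Lambda>(n) n^{-s} \<ge> 0$ by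
  orthogonality. So $|P|$ is nonincreasing.\<close>

lemma norm_prod_dseries_lower_bound:
  assumes N: "N > 1"
  obtains c where "c > 0" "\<And>s. 1 < s \<Longrightarrow> s \<le> 2 \<Longrightarrow> c \<le> norm (\<Prod>\<psi> | dirichlet_char N \<psi>. dseries \<psi> s)"
proof -
  define X where "X = {\<psi>. dirichlet_char N \<psi>}"
  define P where "P = (\<lambda>s. \<Prod>\<psi>\<in>X. dseries \<psi> s)"
  have N0: "N > 0" using N by simp
  have fin: "finite X" unfolding X_def by (rule finite_dirichlet_char[OF N0])
  have deriv: "((\<lambda>s. \<Prod>\<psi>\<in>Y. dseries \<psi> s) has_vector_derivative
      - ((\<Sum>\<psi>\<in>Y. dseries_mangoldt \<psi> s) * (\<Prod>\<psi>\<in>Y. dseries \<psi> s))) (at s)" if "Y \<subseteq> X" "s > 1" for Y s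
    using finite_subset[OF that(1) fin] that
  proof (induction Y rule: finite_induct)
    case (insert \<psi> Y)
    have \<psi>: "dirichlet_char N \<psi>" using insert.prems by (simp add: X_def)
    have "(dseries \<psi> has_vector_derivative - (dseries_mangoldt \<psi> s * dseries \<psi> s)) (at s)"
      using dseries_deriv[OF norm_dirichlet_char_le_1[OF \<psi> N0] \<open>s > 1\<close>]
      by (simp only: dseries_mangoldt_times_dseries[OF \<psi> N0 \<open>s > 1\<close>])
    from has_vector_derivative_mult[OF this insert.IH]
    show ?case using insert by (simp add: algebra_simps)
  qed simp
  have mono: "norm (P 3) \<le> norm (P s)" if s: "1 < s" "s \<le> 2" for s
  proof -
    \<comment> \<open>The squared norm is used because it is differentiable everywhere as a bilinear
      expression in \<open>P\<close>.\<close>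
    have "P 3 \<bullet> P 3 \<le> P s \<bullet> P s"
    proof (rule DERIV_nonpos_imp_nonincreasing[of s 3 "\<lambda>x. P x \<bullet> P x"])
      fix x assume x: "s \<le> x" "x \<le> 3"
      define \<tau> where "\<tau> = real (card X) * (\<Sum>n. if [1 * n = 1] (mod N) then mangoldt n * real n powr - x else 0)"
      have "\<tau> \<ge> 0" unfolding \<tau>_def
        using sum_dseries_mangoldt(1)[OF N, of x 1] x s
        by (intro mult_nonneg_nonneg suminf_nonneg) (auto simp: mangoldt_nonneg)
      have "(\<Sum>\<psi>\<in>X. dseries_mangoldt \<psi> x) = (\<Sum>\<psi>\<in>X. \<psi> 1 * dseries_mangoldt \<psi> x)"
        by (intro sum.cong) (auto simp: X_def dirichlet_char_1)
      also have "\<dots> = of_real \<tau>"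
        unfolding X_def \<tau>_def by (rule sum_dseries_mangoldt(2)[OF N]) (use x s in auto)
      finally have "(P has_vector_derivative - (\<tau> *\<^sub>R P x)) (at x)"
        using deriv[of X x] x s by (simp add: P_def scaleR_conv_of_real)
      from bounded_bilinear.has_vector_derivative[OF bounded_bilinear_inner this this]
      have "((\<lambda>x. P x \<bullet> P x) has_real_derivative - (2 * \<tau> * (P x \<bullet> P x))) (at x)"
        by (simp add: has_real_derivative_iff_has_vector_derivative mult.assoc)
      moreover have "- (2 * \<tau> * (P x \<bullet> P x)) \<le> 0" using \<open>\<tau> \<ge> 0\<close> by simp
      ultimately show "\<exists>y. ((\<lambda>x. P x \<bullet> P x) has_real_derivative y) (at x) \<and> y \<le> 0" by blast
    qed (use s in simp)
    thus ?thesis by (simp add: norm_le)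
  qed
  have "P 3 \<noteq> 0"
  proof -
    have "dseries \<psi> 3 \<noteq> 0" if "dirichlet_char N \<psi>" for \<psi>
      using norm_dirichlet_char_le_1[OF that N0] dirichlet_char_1[OF that] by (rule dseries_nonzero_at_3)
    thus ?thesis using fin by (auto simp: P_def X_def)
  qed
  thus ?thesis using that[of "norm (P 3)"] mono by (simp add: P_def X_def)
qed

text \<open>A zero for $\<psi>$ entails one for its conjugate, and two zeros outweigh the simple pole of the
  principal character, contradicting the lower bound for the product.\<close>

lemma dseries_complex_char_nonzero:
  assumes \<psi>: "dirichlet_char N \<psi>" and n: "cnj (\<psi> n) \<noteq> \<psi> n" and N: "N > 1"
  shows "dseries \<psi> 1 \<noteq> 0"
proof
  assume zero: "dseries \<psi> 1 = 0"
  define X where "X = {\<psi>. dirichlet_char N \<psi>}"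
  define \<omega> where "\<omega> = principal_char N"
  define \<phi> where "\<phi> = (\<lambda>n. cnj (\<psi> n))"
  have N0: "N > 0" using N by simp
  have fin: "finite X" unfolding X_def by (rule finite_dirichlet_char[OF N0])
  have \<phi>: "dirichlet_char N \<phi>" unfolding \<phi>_def by (rule dirichlet_char_cnj[OF \<psi>])
  have ne: "\<psi> \<noteq> \<phi>" using n by (metis \<phi>_def)
  have np: "\<psi> \<noteq> \<omega>" "\<phi> \<noteq> \<omega>" 
    using n by (auto simp: \<phi>_def \<omega>_def principal_char_def fun_eq_iff split: if_splits) (metis complex_cnj_one complex_cnj_zero complex_cnj_cnj)+
  have le: "norm (\<theta> k) \<le> 1" if "\<theta> \<in> X" for \<theta> k
    using norm_dirichlet_char_le_1[OF _ N0] that by (simp add: X_def)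
  have zero': "dseries \<phi> 1 = 0"
    using dseries_cnj[of \<psi> 1] bounded_sums_dseries_summable[OF norm_sum_dirichlet_char_le[OF \<psi> _ N0], of 1] np zero
    by (simp add: \<phi>_def \<omega>_def)
  \<comment> \<open>Each factor is measured against its order at 1: a pole for the principal
    character, a zero for \<psi> and \<phi>, boundedness for all others.\<close>
  have bd: "\<exists>K. \<forall>s. 1 < s \<and> s \<le> 2 \<longrightarrow> norm (dseries \<theta> s) \<le> K * (if \<theta> = \<omega> then 1 / (s - 1) else if \<theta> = \<psi> \<or> \<theta> = \<phi> then s - 1 else 1)"
    if \<theta>: "\<theta> \<in> X" for \<theta>
  proof (cases "\<theta> = \<omega>")
    case True
    have le': "norm (\<theta> k) \<le> 1" for k using le[OF \<theta>] .
    have "norm (dseries \<theta> s) \<le> 2 * (1 / (s - 1))" if "1 < s" "s \<le> 2" for s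
    proof -
      have "norm (dseries \<theta> s) \<le> 1 + 1 / (s - 1)" by (rule norm_dseries_le[OF le' that(1)])
      thus ?thesis using that by (simp add: field_simps)
    qed
    thus ?thesis using True by (intro exI[of _ 2]) auto
  next
    case False
    then obtain B where B: "B > 0" "\<And>s. s \<ge> 1 \<Longrightarrow> norm (dseries \<theta> s - dseries \<theta> 1) \<le> B * (s - 1)"
      using dseries_nonprincipal_lipschitz[of N \<theta>] \<theta> N0 unfolding X_def \<omega>_def by (metis mem_Collect_eq)
    show ?thesis
    proof (cases "\<theta> = \<psi> \<or> \<theta> = \<phi>")
      case True
      hence "dseries \<theta> 1 = 0" using zero zero' by auto
      thus ?thesis using B(2) True False by (intro exI[of _ B]) auto
    next
      case F: False
      have "norm (dseries \<theta> s) \<le> (B + norm (dseries \<theta> 1)) * 1" if "1 < s" "s \<le> 2" for s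
      proof -
        have "norm (dseries \<theta> s) \<le> norm (dseries \<theta> 1) + B * (s - 1)"
          using norm_triangle_sub[of "dseries \<theta> s" "dseries \<theta> 1"] B(2)[of s] that by simp
        moreover have "B * (s - 1) \<le> B * 1" using that B(1) by (intro mult_left_mono) auto
        ultimately show ?thesis by simp
      qed
      thus ?thesis using False F by (intro exI[of _ "B + norm (dseries \<theta> 1)"]) auto
    qed
  qed
  then obtain K where K: "\<And>\<theta> s. \<theta> \<in> X \<Longrightarrow> 1 < s \<Longrightarrow> s \<le> 2 \<Longrightarrow>
      norm (dseries \<theta> s) \<le> K \<theta> * (if \<theta> = \<omega> then 1 / (s - 1) else if \<theta> = \<psi> \<or> \<theta> = \<phi> then s - 1 else 1)"
    by metis
  obtain c where c: "c > 0" "\<And>s. 1 < s \<Longrightarrow> s \<le> 2 \<Longrightarrow> c \<le> norm (\<Prod>\<theta>\<in>X. dseries \<theta> s)"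
    using norm_prod_dseries_lower_bound[OF N] unfolding X_def by blast
  have up: "c \<le> (\<Prod>\<theta>\<in>X. K \<theta>) * (s - 1)" if s: "1 < s" "s \<le> 2" for s
  proof -
    define w where "w = (\<lambda>\<theta>. if \<theta> = \<omega> then 1 / (s - 1) else if \<theta> = \<psi> \<or> \<theta> = \<phi> then s - 1 else 1)"
    have "c \<le> (\<Prod>\<theta>\<in>X. norm (dseries \<theta> s))" using c(2)[OF s] by (simp add: prod_norm)
    also have "\<dots> \<le> (\<Prod>\<theta>\<in>X. K \<theta> * w \<theta>)"
      using K[OF _ s] by (intro prod_mono) (auto simp: w_def)
    also have "\<dots> = (\<Prod>\<theta>\<in>X. K \<theta>) * (\<Prod>\<theta>\<in>X. w \<theta>)" by (rule prod.distrib)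
    \<comment> \<open>All other weights are 1, and one pole times two zeros leaves a single factor
      \<open>s - 1\<close>.\<close>
    also have "(\<Prod>\<theta>\<in>X. w \<theta>) = (\<Prod>\<theta>\<in>{\<omega>, \<psi>, \<phi>}. w \<theta>)"
      using \<psi> \<phi> dirichlet_char_principal fin by (intro prod.mono_neutral_right) (auto simp: X_def \<omega>_def w_def)
    also have "\<dots> = s - 1" using ne np s by (simp add: w_def)
    finally show ?thesis .
  qed
  have "((\<lambda>s. (\<Prod>\<theta>\<in>X. K \<theta>) * (s - 1)) \<longlongrightarrow> (\<Prod>\<theta>\<in>X. K \<theta>) * (1 - 1)) (at_right (1::real))"
    by (intro tendsto_intros)
  moreover have "eventually (\<lambda>s. c \<le> (\<Prod>\<theta>\<in>X. K \<theta>) * (s - 1)) (at_right (1::real))"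
    unfolding eventually_at_right_field by (rule exI[of _ 2]) (use up in auto)
  ultimately have "c \<le> (\<Prod>\<theta>\<in>X. K \<theta>) * (1 - 1)" by (rule tendsto_lowerbound) simp
  thus False using c(1) by simp
qed

lemma dseries_nonprincipal_nonzero:
  assumes \<psi>: "dirichlet_char N \<psi>" "\<psi> \<noteq> principal_char N" and N: "N > 1"
  shows "dseries \<psi> 1 \<noteq> 0"
proof (cases "\<forall>n. cnj (\<psi> n) = \<psi> n")
  case True
  hence "\<psi> n = of_real (Re (\<psi> n))" for n by (metis Reals_cnj_iff of_real_Re)
  thus ?thesis by (rule dseries_real_char_nonzero[OF \<psi> _ N])
qed (use dseries_complex_char_nonzero[OF \<psi>(1) _ N] in blast)

section \<open>Primes in arithmetic progressions\<close>

lemma dseries_mangoldt_bounded: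
  assumes \<psi>: "dirichlet_char N \<psi>" "\<psi> \<noteq> principal_char N" and N: "N > 1"
  shows "\<exists>K. eventually (\<lambda>s. norm (dseries_mangoldt \<psi> s) \<le> K) (at_right 1)"
proof -
  have N0: "N > 0" using N by simp
  obtain B where B: "B > 0" "\<And>s. s \<ge> 1 \<Longrightarrow> norm (dseries_ln \<psi> s) \<le> B"
    "\<And>s. s \<ge> 1 \<Longrightarrow> norm (dseries \<psi> s - dseries \<psi> 1) \<le> B * (s - 1)"
    using dseries_nonprincipal_lipschitz[OF \<psi> N0] by blast
  define l where "l = norm (dseries \<psi> 1)"
  have l: "l > 0" using dseries_nonprincipal_nonzero[OF \<psi> N] by (simp add: l_def)
  \<comment> \<open>The radius \<open>l / (2 * B)\<close> keeps the Lipschitz error within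
    \<open>l / 2\<close>, so the denominator of L'/L stays at least \<open>l / 2\<close>.\<close>
  have "norm (dseries_mangoldt \<psi> s) \<le> 2 * B / l" if s: "1 < s" "s < 1 + l / (2 * B)" for s
  proof -
    have "B * (s - 1) \<le> l / 2" using s B(1) by (simp add: field_simps)
    hence "norm (dseries \<psi> s) \<ge> l / 2"
      using B(3)[of s] s norm_triangle_sub[of "dseries \<psi> 1" "dseries \<psi> s"]
      by (simp add: l_def norm_minus_commute)
    hence "norm (dseries_mangoldt \<psi> s) * (l / 2) \<le> norm (dseries_mangoldt \<psi> s) * norm (dseries \<psi> s)"
      by (intro mult_left_mono) auto
    also have "\<dots> = norm (dseries_ln \<psi> s)"
      using dseries_mangoldt_times_dseries[OF \<psi>(1) N0 s(1)] by (metis norm_mult)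
    also have "\<dots> \<le> B" using B(2) s by simp
    finally show ?thesis using l by (simp add: field_simps)
  qed
  moreover have "1 + l / (2 * B) > 1" using l B by simp
  ultimately show ?thesis unfolding eventually_at_right_field by blast
qed

text \<open>The numbers j N + 1 are coprime to \<open>N\<close>, and N/(j N + 1) >= 1/(j + 1)
  compares their reciprocals with the harmonic series.\<close>

lemma principal_dseries_unbounded:
  assumes N: "N > 0"
  shows "\<exists>m. (\<Sum>n<m. if coprime n N then 1 / real n else 0) \<ge> K"
proof (rule ccontr)
  define f where "f = (\<lambda>n. if coprime n N then 1 / real n else 0)"
  assume "\<not> ?thesis"
  hence "summable f"
    by (intro summableI_nonneg_bounded[where x = K]) (auto simp: f_def not_le less_imp_le)
  hence "summable (f \<circ> (\<lambda>j. j * N + 1))"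
    by (rule summable_reindex) (use N in \<open>auto simp: f_def inj_def\<close>)
  hence "summable (\<lambda>j. f (j * N + 1))" by (simp add: o_def)
  moreover have "f (j * N + 1) = 1 / real (j * N + 1)" for j
  proof -
    have "coprime (j * N + 1) N" by (rule coprimeI) (metis dvd_add_right_iff dvd_mult)
    thus ?thesis by (simp add: f_def)
  qed
  ultimately have sm: "summable (\<lambda>j. real N * (1 / real (j * N + 1)))" by (intro summable_mult) simp
  have le: "norm (inverse (real (Suc j))) \<le> real N * (1 / real (j * N + 1))" for j
  proof -
    have "real (j * N + 1) \<le> real (Suc j * N)" using N by (simp flip: of_nat_mult)
    hence "real N * (1 / real (Suc j * N)) \<le> real N * (1 / real (j * N + 1))"
      using N by (intro mult_left_mono divide_left_mono) (auto simp del: of_nat_add of_nat_mult)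
    moreover have "real N * (1 / real (Suc j * N)) = inverse (real (Suc j))"
      using N by (simp only: of_nat_mult) (simp add: inverse_eq_divide)
    ultimately show ?thesis by simp
  qed
  have "summable (\<lambda>j. inverse (real (Suc j)))"
    by (rule summable_comparison_test'[OF sm, where N = 0]) (rule le)
  thus False using not_summable_harmonic[where ?'a = real] summable_Suc_iff[of "\<lambda>n. inverse (real n)"] by blast
qed

text \<open>In -L' the weight ln n is at least ln M except for the first M terms, whose deficit is
  at most M ln M. Hence -L' >= ln M (L - M), and -L'/L is at least half of ln M as soon as L > 2
  M.\<close>

lemma dseries_mangoldt_principal_unbounded:
  assumes N: "N > 0"
  shows "eventually (\<lambda>s. norm (dseries_mangoldt (principal_char N) s) \<ge> K) (at_right 1)"
proof -
  define c where "c = (\<lambda>n. if coprime n N then 1 else 0 :: real)"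
  obtain M :: nat where M: "M \<ge> 1" "ln (real M) \<ge> 2 * \<bar>K\<bar>"
  proof -
    obtain M where "exp (2 * \<bar>K\<bar>) \<le> real M" using real_arch_simple by blast
    moreover have "1 \<le> exp (2 * \<bar>K\<bar>)" by simp
    ultimately have "1 \<le> real M" by linarith
    moreover have "ln (real M) \<ge> 2 * \<bar>K\<bar>"
      using \<open>exp (2 * \<bar>K\<bar>) \<le> real M\<close> \<open>1 \<le> real M\<close> by (subst ln_ge_iff) auto
    ultimately show ?thesis using that[of M] by simp
  qed
  obtain m where m: "(\<Sum>n<m. if coprime n N then 1 / real n else 0) \<ge> 2 * real M + 1"
    using principal_dseries_unbounded[OF N] by blast
  \<comment> \<open>A finite partial sum is continuous in \<open>s\<close>, so exceeding
    \<open>2 * M\<close> at 1 carries over to nearby \<open>s\<close>.\<close>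
  have "((\<lambda>s. \<Sum>n<m. c n * real n powr - s) \<longlongrightarrow> (\<Sum>n<m. c n * real n powr - 1)) (at_right 1)"
    by (intro tendsto_sum tendsto_mult tendsto_const) (auto intro!: tendsto_eq_intros simp: powr_def)
  moreover have "(\<Sum>n<m. c n * real n powr - 1) > 2 * real M"
  proof -
    have "(\<Sum>n<m. c n * real n powr - 1) = (\<Sum>n<m. if coprime n N then 1 / real n else 0)"
      by (intro sum.cong) (auto simp: c_def powr_minus divide_inverse)
    thus ?thesis using m by simp
  qed
  ultimately have "eventually (\<lambda>s. (\<Sum>n<m. c n * real n powr - s) > 2 * real M) (at_right 1)"
    by (rule order_tendstoD(1))
  moreover have "eventually (\<lambda>s::real. s > 1) (at_right 1)" by (simp add: eventually_at_right_less)
  ultimately show ?thesis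
  proof eventually_elim
    case (elim s)
    define l where "l = (\<Sum>n. c n * real n powr - s)"
    define d where "d = (\<Sum>n. c n * (ln (real n) * real n powr - s))"
    have pc: "principal_char N n = of_real (c n)" for n by (simp add: principal_char_def c_def)
    note le = norm_dirichlet_char_le_1[OF dirichlet_char_principal N]
    have c_abs: "\<bar>c n\<bar> = c n" for n by (simp add: c_def)
    have sl: "summable (\<lambda>n. c n * real n powr - s)"
    proof -
      have "summable (\<lambda>n. norm (principal_char N n * of_real (real n powr - s)))"
        using le elim(2) by (rule dseries_abs_summable)
      thus ?thesis by (simp add: pc norm_mult c_abs)
    qed
    have ln_nn: "\<bar>ln (real n)\<bar> = ln (real n)" for n by (cases "n = 0") auto
    have sd: "summable (\<lambda>n. c n * (ln (real n) * real n powr - s))"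
    proof -
      have "summable (\<lambda>n. norm (principal_char N n * of_real (ln (real n) * real n powr - s)))"
        using le elim(2) by (rule dseries_ln_abs_summable)
      thus ?thesis by (simp add: pc norm_mult c_abs ln_nn)
    qed
    have L: "dseries (principal_char N) s = of_real l"
      using sums_of_real[OF summable_sums[OF sl], where ?'a = complex]
      by (simp add: dseries_def pc l_def sums_iff)
    have D: "dseries_ln (principal_char N) s = of_real d"
      using sums_of_real[OF summable_sums[OF sd], where ?'a = complex]
      by (simp add: dseries_ln_def pc d_def sums_iff)
    have "(\<Sum>n<m. c n * real n powr - s) \<le> l"
      unfolding l_def by (rule sum_le_suminf[OF sl]) (auto simp: c_def)
    hence l: "l > 2 * real M" using elim(1) by simp
    have "d - ln (real M) * l = (\<Sum>n. c n * ((ln (real n) - ln (real M)) * real n powr - s))"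
      unfolding d_def l_def suminf_mult[OF sl, symmetric]
      by (subst suminf_diff[OF sd summable_mult[OF sl]]) (simp add: algebra_simps)
    also have "\<dots> \<ge> (\<Sum>n<M. c n * ((ln (real n) - ln (real M)) * real n powr - s))"
    proof (rule sum_le_suminf)
      show "summable (\<lambda>n. c n * ((ln (real n) - ln (real M)) * real n powr - s))"
        using summable_diff[OF sd summable_mult[OF sl, of "ln (real M)"]] by (simp add: algebra_simps)
      show "0 \<le> c n * ((ln (real n) - ln (real M)) * real n powr - s)" if "n \<in> - {..<M}" for n
        using that M(1) by (auto simp: c_def)
    qed auto
    also have "(\<Sum>n<M. c n * ((ln (real n) - ln (real M)) * real n powr - s)) \<ge> (\<Sum>n<M. - ln (real M))"
    proof (rule sum_mono)
      fix n assume n: "n \<in> {..<M}"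
      have lnM: "ln (real M) \<ge> 0" using M(1) by simp
      show "- ln (real M) \<le> c n * ((ln (real n) - ln (real M)) * real n powr - s)"
      proof (cases "n = 0")
        case False
        have "real n powr - s \<le> real n powr 0" using False elim(2) by (intro powr_mono) auto
        hence "(ln (real M) - ln (real n)) * real n powr - s \<le> ln (real M) * 1"
          using False n M(1) by (intro mult_mono) auto
        thus ?thesis using lnM by (auto simp: c_def algebra_simps)
      qed (use lnM in simp)
    qed
    finally have dl: "d \<ge> ln (real M) * (l - real M)" by (simp add: algebra_simps)
    have l0: "l > 0" using l M(1) by simp
    have "\<bar>K\<bar> * l \<le> ln (real M) * (l - real M)"
    proof -
      have "\<bar>K\<bar> * l \<le> ln (real M) / 2 * l" using M(2) l0 by (intro mult_right_mono) auto
      also have "\<dots> = ln (real M) * (l / 2)" by simp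
      also have "\<dots> \<le> ln (real M) * (l - real M)" using l M(1) by (intro mult_left_mono) auto
      finally show ?thesis .
    qed
    hence "\<bar>K\<bar> * l \<le> norm (dseries_ln (principal_char N) s)" using dl by (simp add: D)
    also have "\<dots> = norm (dseries_mangoldt (principal_char N) s) * l"
      using dseries_mangoldt_times_dseries[OF dirichlet_char_principal N elim(2)] L l0
      by (metis abs_of_pos norm_mult norm_of_real)
    finally show "K \<le> norm (dseries_mangoldt (principal_char N) s)" using l0 by simp
  qed
qed

text \<open>Only proper prime powers contribute. For fixed p the terms ln p / p^k with k >= 2 form a
  geometric series of sum at most 2 ln p / p^2.\<close>

lemma summable_mangoldt_nonprime:
  "summable (\<lambda>n. if prime n then 0 else mangoldt n / real n)" (is "summable ?g")
proof -
  define g where "g = (\<lambda>n. if prime n then 0 else mangoldt n / real n :: real)"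
  \<comment> \<open>\<open>h (p, k)\<close> stands for the power p^(k+1), so \<open>k = 0\<close> is
    the prime itself and gets the value 0.\<close>
  define h where "h = (\<lambda>(p, k). if k = 0 then 0 else ln (real p) / real p ^ Suc k :: real)"
  have gh: "g (p ^ Suc k) = h (p, k)" if "prime p" for p k
  proof -
    have "prime (p ^ Suc k) \<longleftrightarrow> k = 0" using that prime_power_iff[of p "Suc k"] by auto
    moreover have "mangoldt (p ^ Suc k) = (ln (real p) :: real)" using that mangoldt_primepow'[of p "Suc k"] by (simp del: power_Suc)
    ultimately show ?thesis by (simp add: g_def h_def del: power_Suc)
  qed
  have "h summable_on ({p. prime p} \<times> UNIV)"
  proof (rule summable_on_SigmaI)
    fix p :: nat assume "p \<in> {p. prime p}"
    hence p: "real p \<ge> 2" using prime_ge_2_nat[of p] by simp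
    have "(\<lambda>k. (1 / real p) ^ k) sums (1 / (1 - 1 / real p))" using p by (intro geometric_sums) auto
    hence "((\<lambda>k. (1 / real p) ^ k) has_sum (1 / (1 - 1 / real p))) UNIV"
      by (rule sums_nonneg_imp_has_sum) auto
    hence "((\<lambda>k. ln (real p) / real p ^ 2 * (1 / real p) ^ k) has_sum (ln (real p) / real p ^ 2 * (1 / (1 - 1 / real p)))) UNIV"
      by (rule has_sum_cmult_right)
    moreover have "ln (real p) / real p ^ 2 * (1 / real p) ^ k = h (p, Suc k)" for k
      by (simp add: h_def power_divide power2_eq_square)
    ultimately have "((\<lambda>k. h (p, Suc k)) has_sum (ln (real p) / real p ^ 2 * (1 / (1 - 1 / real p)))) UNIV"
      by simp
    also have "?this \<longleftrightarrow> ((\<lambda>k. h (p, k)) has_sum (ln (real p) / real p ^ 2 * (1 / (1 - 1 / real p)))) {0<..}"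
      by (rule has_sum_reindex_bij_betw[where f = "\<lambda>k. h (p, k)"])
         (rule bij_betw_byWitness[where f' = "\<lambda>n. n - 1"], auto)
    also have "\<dots> \<longleftrightarrow> ((\<lambda>k. h (p, k)) has_sum (ln (real p) / real p ^ 2 * (1 / (1 - 1 / real p)))) UNIV"
      by (rule has_sum_cong_neutral) (auto simp: h_def)
    finally show "((\<lambda>k. h (p, k)) has_sum (ln (real p) / real p ^ 2 * (1 / (1 - 1 / real p)))) UNIV" .
  next
    have "summable (\<lambda>n. 2 * (ln (real n) * real n powr - 2))"
      by (intro summable_mult summable_ln_powr) auto
    hence "(\<lambda>n. 2 * (ln (real n) * real n powr - 2)) summable_on UNIV"
    proof (subst summable_on_UNIV_nonneg_real_iff)
      show "0 \<le> 2 * (ln (real n) * real n powr - 2)" for n :: nat by (cases "n = 0") auto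
    qed
    hence "(\<lambda>n. 2 * (ln (real n) * real n powr - 2)) summable_on {p. prime p}" by (rule summable_on_subset_banach) simp
    thus "(\<lambda>p. ln (real p) / real p ^ 2 * (1 / (1 - 1 / real p))) summable_on {p. prime p}"
    proof (rule summable_on_comparison_test)
      fix p :: nat assume "p \<in> {p. prime p}"
      hence p: "real p \<ge> 2" using prime_ge_2_nat[of p] by simp
      hence "1 / (1 - 1 / real p) \<le> 2" by (simp add: field_simps)
      hence "ln (real p) / real p ^ 2 * (1 / (1 - 1 / real p)) \<le> ln (real p) / real p ^ 2 * 2"
        using p by (intro mult_left_mono) auto
      thus "ln (real p) / real p ^ 2 * (1 / (1 - 1 / real p)) \<le> 2 * (ln (real p) * real p powr - 2)"
        using p by (simp add: powr_minus powr_numeral divide_inverse)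
      show "0 \<le> ln (real p) / real p ^ 2 * (1 / (1 - 1 / real p))"
        using p by (intro mult_nonneg_nonneg divide_nonneg_nonneg) auto
    qed
  next
    fix p k :: nat assume "p \<in> {p. prime p}"
    hence "p \<ge> 1" using prime_ge_1_nat by simp
    thus "h (p, k) \<ge> 0" by (simp add: h_def)
  qed
  also have "?this \<longleftrightarrow> (\<lambda>(p, k). g (p ^ Suc k)) summable_on ({p. prime p} \<times> UNIV)"
    by (rule summable_on_cong) (use gh in auto)
  also have "\<dots> \<longleftrightarrow> g summable_on {n. primepow n}"
    using summable_on_reindex_bij_betw[OF bij_betw_primepows, of g] by (simp add: case_prod_unfold)
  also have "\<dots> \<longleftrightarrow> g summable_on UNIV"
    by (rule summable_on_cong_neutral) (auto simp: g_def mangoldt_def)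
  finally show ?thesis unfolding g_def by (rule summable_on_imp_summable)
qed

theorem infinite_primes_cong:
  fixes b N :: nat
  assumes N: "N > 1" and b: "coprime b N"
  shows "infinite {p. prime p \<and> [p = b] (mod N)}"
proof
  assume fin_primes: "finite {p. prime p \<and> [p = b] (mod N)}"
  define Q where "Q = {p. prime p \<and> [p = b] (mod N)}"
  define X where "X = {\<psi>. dirichlet_char N \<psi>}"
  define \<omega> where "\<omega> = principal_char N"
  have N0: "N > 0" using N by simp
  have fin: "finite X" unfolding X_def by (rule finite_dirichlet_char[OF N0])
  have \<omega>: "\<omega> \<in> X" by (simp add: X_def \<omega>_def dirichlet_char_principal)
  \<comment> \<open>The inverse \<open>a\<close> of \<open>b\<close> spares the conjugates in the
    orthogonality relation: \<open>\<psi> a\<close> is the conjugate of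
    \<open>\<psi> b\<close>.\<close>
  obtain a where a: "[b * a = 1] (mod N)" using b cong_solve_coprime_nat by auto
  hence copa: "coprime a N" by (metis coprime_iff_invertible_nat mult.commute One_nat_def)
  have aQ: "[n = b] (mod N)" if "[a * n = 1] (mod N)" for n
  proof -
    have "[a * n = a * b] (mod N)" using that a by (metis cong_sym cong_trans mult.commute)
    thus ?thesis using copa by (simp add: cong_mult_lcancel_nat)
  qed
  define G where "G = (\<lambda>n. if prime n then 0 else mangoldt n / real n :: real)"
  \<comment> \<open>A bound independent of \<open>s\<close>: the finitely many primes of the class
    with their powers n^(-s) replaced by 1, and all proper prime powers taken at
    \<open>s = 1\<close>.\<close>
  define K where "K = (\<Sum>p\<in>Q. mangoldt p) + (\<Sum>n. G n)"
  have f_le: "(\<Sum>n. if [a * n = 1] (mod N) then mangoldt n * real n powr - s else 0) \<le> K" if s: "s > 1" for s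
  proof -
    have pw: "real n powr - s \<le> 1 / real n" "real n powr - s \<le> 1" for n
    proof -
      have "real n powr - s \<le> real n powr - 1" if "n > 0" using that s by (intro powr_mono) auto
      thus "real n powr - s \<le> 1 / real n" by (cases "n = 0") (auto simp: powr_minus divide_inverse)
      thus "real n powr - s \<le> 1" by (rule order.trans) (cases "n = 0", auto)
    qed
    have S: "(\<lambda>n. if n \<in> Q then mangoldt n else 0) sums (\<Sum>p\<in>Q. mangoldt p :: real)"
      using fin_primes unfolding Q_def[symmetric] by (rule sums_If_finite_set)
    have sG: "G sums (\<Sum>n. G n)" unfolding G_def by (rule summable_sums[OF summable_mangoldt_nonprime])
    have "(\<Sum>n. if [a * n = 1] (mod N) then mangoldt n * real n powr - s else 0)
        \<le> (\<Sum>n. (if n \<in> Q then mangoldt n else 0) + G n)"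
    proof (rule suminf_le)
      fix n
      have "mangoldt n * real n powr - s \<le> mangoldt n * 1" "mangoldt n * real n powr - s \<le> mangoldt n * (1 / real n)"
        using pw[of n] by (intro mult_left_mono mangoldt_nonneg; simp)+
      thus "(if [a * n = 1] (mod N) then mangoldt n * real n powr - s else 0) \<le> (if n \<in> Q then mangoldt n else 0) + G n"
        using aQ[of n] mangoldt_nonneg[of n] by (auto simp: Q_def G_def)
    qed (use sum_dseries_mangoldt(1)[OF N s, of a] sums_summable[OF sums_add[OF S sG]] in auto)
    also have "\<dots> = K" using sums_add[OF S sG] by (simp add: K_def sums_iff)
    finally show ?thesis .
  qed
  have "\<forall>\<psi>\<in>X - {\<omega>}. \<exists>K. eventually (\<lambda>s. norm (dseries_mangoldt \<psi> s) \<le> K) (at_right 1)"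
    using dseries_mangoldt_bounded[OF _ _ N] by (auto simp: X_def \<omega>_def)
  then obtain B where B: "\<And>\<psi>. \<psi> \<in> X - {\<omega>} \<Longrightarrow> eventually (\<lambda>s. norm (dseries_mangoldt \<psi> s) \<le> B \<psi>) (at_right 1)"
    by metis
  \<comment> \<open>The most that orthogonality leaves for the principal character once all other
    characters are moved to the other side.\<close>
  define T where "T = real (card X) * K + (\<Sum>\<psi>\<in>X - {\<omega>}. B \<psi>)"
  have "eventually (\<lambda>s. \<forall>\<psi>\<in>X - {\<omega>}. norm (dseries_mangoldt \<psi> s) \<le> B \<psi>) (at_right 1)"
    using fin B by (intro eventually_ball_finite) auto
  moreover have "eventually (\<lambda>s. norm (dseries_mangoldt \<omega> s) \<ge> T + 1) (at_right 1)"
    unfolding \<omega>_def by (rule dseries_mangoldt_principal_unbounded[OF N0])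
  moreover have "eventually (\<lambda>s::real. s > 1) (at_right 1)" by (simp add: eventually_at_right_less)
  ultimately have "eventually (\<lambda>s::real. False) (at_right 1)"
  proof eventually_elim
    case (elim s)
    define F where "F = (\<Sum>n. if [a * n = 1] (mod N) then mangoldt n * real n powr - s else 0)"
    have "F \<ge> 0" unfolding F_def
      using sum_dseries_mangoldt(1)[OF N elim(3), of a] by (intro suminf_nonneg) (auto simp: mangoldt_nonneg)
    have "(\<Sum>\<psi>\<in>X. \<psi> a * dseries_mangoldt \<psi> s) = of_real (real (card X) * F)"
      unfolding X_def F_def by (rule sum_dseries_mangoldt(2)[OF N elim(3)])
    hence "\<omega> a * dseries_mangoldt \<omega> s = of_real (real (card X) * F) - (\<Sum>\<psi>\<in>X - {\<omega>}. \<psi> a * dseries_mangoldt \<psi> s)"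
      using sum.remove[OF fin \<omega>, of "\<lambda>\<psi>. \<psi> a * dseries_mangoldt \<psi> s"] by (simp add: algebra_simps)
    moreover have "\<omega> a = 1" using copa by (simp add: \<omega>_def principal_char_def)
    ultimately have "norm (dseries_mangoldt \<omega> s) \<le> norm (of_real (real (card X) * F) :: complex) + norm (\<Sum>\<psi>\<in>X - {\<omega>}. \<psi> a * dseries_mangoldt \<psi> s)"
      by (simp only: mult_1_left) (rule norm_triangle_ineq4)
    also have "norm (of_real (real (card X) * F) :: complex) = real (card X) * F"
      using \<open>F \<ge> 0\<close> by (simp only: norm_of_real abs_mult abs_of_nat abs_of_nonneg)
    also have "\<dots> \<le> real (card X) * K"
      using f_le[OF elim(3)] unfolding F_def by (intro mult_left_mono) auto
    also have "norm (\<Sum>\<psi>\<in>X - {\<omega>}. \<psi> a * dseries_mangoldt \<psi> s) \<le> (\<Sum>\<psi>\<in>X - {\<omega>}. B \<psi>)"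
    proof (rule sum_norm_le)
      fix \<psi> assume \<psi>: "\<psi> \<in> X - {\<omega>}"
      have "norm (\<psi> a * dseries_mangoldt \<psi> s) = norm (dseries_mangoldt \<psi> s)"
        using norm_dirichlet_char[OF _ copa N0, of \<psi>] \<psi> by (simp add: norm_mult X_def)
      thus "norm (\<psi> a * dseries_mangoldt \<psi> s) \<le> B \<psi>" using elim(1) \<psi> by simp
    qed
    finally show False using elim(2) by (simp add: T_def)
  qed
  thus False by (simp add: eventually_False)
qed

section \<open>Covering systems of congruences\<close>

text \<open>A residue modulo \<open>M\<close> decides membership in a class modulo \<open>k\<close>
  only if \<open>k\<close> divides \<open>M\<close>; the other triples wait for a larger
  \<open>M\<close>.\<close>

definition uncovered :: "(nat \<times> nat \<times> nat) list \<Rightarrow> nat \<Rightarrow> nat list \<Rightarrow> nat list" where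
  "uncovered C M rs = filter (\<lambda>r. list_all (\<lambda>(q, k, e). k dvd M \<longrightarrow> r mod k \<noteq> e) C) rs"

text \<open>Refines the residues that are not yet covered to larger and larger moduli.\<close>

primrec covers :: "(nat \<times> nat \<times> nat) list \<Rightarrow> nat list \<Rightarrow> nat \<Rightarrow> nat list \<Rightarrow> bool" where
  "covers C [] M rs \<longleftrightarrow> uncovered C M rs = []"
| "covers C (f # fs) M rs \<longleftrightarrow>
     covers C fs (M * f) (concat (map (\<lambda>i. map (\<lambda>r. M * i + r) (uncovered C M rs)) [0..<f]))"

lemma covers_sound:
  assumes "covers C fs M rs" "n mod M \<in> set rs" "\<forall>f\<in>set fs. f > 0"
  shows "\<exists>(q, k, e)\<in>set C. n mod k = e"
  using assms
proof (induction fs arbitrary: M rs)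
  case Nil
  hence "n mod M \<notin> set (uncovered C M rs)" by simp
  hence "\<exists>(q, k, e)\<in>set C. k dvd M \<and> n mod M mod k = e"
    using Nil.prems by (auto simp: uncovered_def list_all_iff)
  thus ?case by (fastforce simp: mod_mod_cancel)
next
  case (Cons f fs)
  show ?case
  proof (cases "n mod M \<in> set (uncovered C M rs)")
    case True
    define i where "i = n div M mod f"
    have "i < f" using Cons.prems by (simp add: i_def)
    moreover have "n mod (M * f) = M * i + n mod M" by (simp add: mod_mult2_eq i_def)
    ultimately have "n mod (M * f) \<in> set (concat (map (\<lambda>i. map (\<lambda>r. M * i + r) (uncovered C M rs)) [0..<f]))"
      using True by auto
    thus ?thesis using Cons.IH Cons.prems by simp
  next
    case False
    hence "\<exists>(q, k, e)\<in>set C. k dvd M \<and> n mod M mod k = e"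
      using Cons.prems by (auto simp: uncovered_def list_all_iff)
    thus ?thesis by (fastforce simp: mod_mod_cancel)
  qed
qed

text \<open>Every entry except 2 occurs in one of the coverings below. The Sierpinski covering uses
  the prime factors of 2^64 - 1, that is the Fermat primes 3, 5, 17, 257, 65537 and the factors 641
  and 6700417 of 2^32 + 1.\<close>

definition covering_primes :: "nat list" where
  "covering_primes = [2, 3, 5, 7, 11, 13, 17, 19, 31, 37, 41, 61, 73, 101, 137, 151, 257, 331, 631, 641,
     757, 1321, 23311, 52579, 61681, 65537, 333667, 414721, 6700417, 18837001, 70541929,
     4278255361, 14175966169, 44479210368001, 440334654777631]"

lemma A_const_eq: "A_const = prod_list covering_primes"
  by (simp add: A_const_def covering_primes_def)

text \<open>The quotients are spelled out because checking a product is much cheaper for the simplifier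
  than dividing a numeral of this size.\<close>

lemma B_const_divisions:
  "B_const = 2 * 146067323861889079957481270103911570167563172016605132112642783029979978186136985180248154047960231834524161563258542944176907208640622391 + 1"
  "B_const = 3 * 97378215907926053304987513402607713445042114677736754741761855353319985457424656786832102698640154556349441042172361962784604805760414927 + 2"
  "B_const = 5 * 58426929544755631982992508041564628067025268806642052845057113211991991274454794072099261619184092733809664625303417177670762883456248956 + 3"
  "B_const = 7 * 41733521103396879987851791458260448619303763433315752032183652294279993767467710051499472585131494809864046160931012269764830631040177826 + 1"
  "B_const = 11 * 26557695247616196355905685473438467303193304003019114929571415096359996033843088214590573463265496697186211193319735080759437674298294980 + 3"
  "B_const = 13 * 22471895978752166147304810785217164641163564925631558786560428158458458182482613104653562161224651051465255625116698914488754955175480367 + 12"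
  "B_const = 17 * 17184391042575185877350737659283714137360373178424133189722680356468232727780821785911547535054144921708724889795122699314930259840073222 + 9"
  "B_const = 19 * 15375507774935692627103291589885428438690860212274224432909766634734734545909156334762963583995813877318332796132478204650200758804276041 + 4"
  "B_const = 31 * 9423698313670263223063307748639456139842785291393879491138244066450321173299160334209558325674853666743494294403776964140445626363911122 + 1"
  "B_const = 37 * 7895531019561571889593582167779003792841252541438115249332042325944863685737134334067467786376228747812116841257218537523076065331925534 + 25"
  "B_const = 41 * 7125235310336052680852744883117637569149423025200250346958184538047803813957901716109666051120011309001178612841880143618385717494664506 + 37"
  "B_const = 61 * 4789092585635707539589549839472510497297153180872299413529271574753441907742196235417972263867548584738497100434706326038587121594774504 + 39"
  "B_const = 73 * 4001844489366824108424144386408536168974333479906989920894322822739177484551698224116387782135896762589703056527631313539093348181934860 + 3"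
  "B_const = 101 * 2892422254690872870445173665423991488466597465675349150745401644158019370022514558024715921741786769000478446797198870181720934824566780 + 3"
  "B_const = 137 * 2132369691414439123466879855531555768869535357906644264418142817955912090308569126718951153984820902693783380485526174367546090637089377 + 134"
  "B_const = 151 * 1934666541217073906721606226541875101557128106180200425333016993774569247498503114970174225800797772642704126665676065485786850445571157 + 76"
  "B_const = 257 * 1136710691532210738968725837384525837879869042930779238230683136420077651253984320468857229945215811941822268974774653262077098899927022 + 129"
  "B_const = 331 * 882582017292381147779343021775900726087994997079185088293914096857885064568803535832315130199155479362683755669235909028259258058251494 + 269"
  "B_const = 631 * 462970915568586624270939049457722884841721622873550339501244954136228140051147338130738998567227359221946629360565904735901449155754746 + 57"
  "B_const = 641 * 455748280380309141833014883319536880398013017212496512051927560155943769691535055164580823862590426940793015797998573928789102055040943 + 320"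
  "B_const = 757 * 385911027376193077826898996311523302952610758300145659478580668507212624005645931784010975027636015414859079427367352560573070564440217 + 514"
  "B_const = 1321 * 221146591766675367081727888120986480193131221826805650435492479984829641462735783770247015969659699976569510315304379930623629384770056 + 807"
  "B_const = 23311 * 12532051294400847664834736399460475326460741453957799503465555577193597716626226689566998760066941086570645752070571227675939016656567 + 11446"
  "B_const = 52579 * 5556108859502427963920244588292343717741424219426201795874504385019874025224404617061874666614436631907193425636035030874566165527705 + 43588"
  "B_const = 61681 * 4736217761122195812567282310724909458911599099126315465464009436616785661261554941724296105703870943549039787398341237793709803947426 + 61677"
  "B_const = 65537 * 4457552950604668506568236876998079563225755588952961902822612662464866508571859718334624839341447787799995775310390861472966635904622 + 32769"
  "B_const = 333667 * 875527540103690685368833418371679369956053023023584184906765026388465015636170104806577540170051169786188994196360700603757082412348 + 324667"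
  "B_const = 414721 * 704412479049235895734632536591643877052587990560425597510821892452901966315363751438910274849647024551561949181539121212462871224946 + 414717"
  "B_const = 6700417 * 43599472648311017047888592636521449386676432829958234573353504126677482367481601572035935688169924897069588822086309835395888706222 + 3350209"
  "B_const = 18837001 * 15508554027457882489625739267509893975963920373163979989451907236186904506310424380212981254071200806808277131084565206975028265767 + 16"
  "B_const = 70541929 * 4141290887066302934740592934562693066348190507140941158913949830603015638717137581543826340443858058787254359411082816977599441847 + 70541920"
  "B_const = 4278255361 * 68283592977370702560772772022437288154928895099492464406283850633375027370712846600578667070340980440846649856279368053447479666 + 4278255357"
  "B_const = 14175966169 * 20607741598778512146642704096864097160298911830255106771007529346478927560727446199966753609703853947526186645382158987879129046 + 9"
  "B_const = 44479210368001 * 6567891950122031267599062836325114980788725923593929290039009087533581939760806969066662440102232459816320381626637908572779 + 4"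
  "B_const = 440334654777631 * 663437784317262416186179728308524207206367991784528311064727217672913532183793436831980146670061789490366805659891706902192 + 440325654777631"
  by (simp_all add: B_const_def)

lemma mod_eq_remainder: "n = q * c + r \<Longrightarrow> r < q \<Longrightarrow> n mod q = r" for n :: nat
  by simp

lemmas B_const_mod = B_const_divisions[THEN mod_eq_remainder]

text \<open>A triple $(q, k, e)$ of a covering asserts that $q$ divides $p b^n + c$ whenever $n \<equiv> e$ modulo $k$
  and $p \<equiv> B$ modulo $A$. Here $b = 2$ and $c = 1$, $-1$ for Sierpinski and Riesel numbers, and $b = 10$
  and $c$ is the final digit for translated unit sensitivity.\<close>

definition sierpinski_cover :: "(nat \<times> nat \<times> nat) list" where
  "sierpinski_cover = [(3, 2, 0), (5, 4, 3), (17, 8, 5), (257, 16, 9), (641, 64, 1), (65537, 32, 17),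
     (6700417, 64, 33)]"

text \<open>The moduli divide 1440. The prime 3 takes the odd exponents here and the even ones in
  the Sierpinski covering, in both cases because \<open>B_const\<close> is 2 modulo 3.\<close>

definition riesel_cover :: "(nat \<times> nat \<times> nat) list" where
  "riesel_cover = [(3, 2, 1), (7, 3, 0), (11, 10, 2), (31, 5, 0), (41, 20, 8), (61, 60, 14),
     (151, 15, 1), (331, 30, 4), (631, 45, 11), (1321, 60, 44), (23311, 45, 26),
     (61681, 40, 18), (414721, 160, 78), (4278255361, 80, 38), (18837001, 90, 86),
     (44479210368001, 160, 158)]"

text \<open>The prime factors of 10^8 - 1 other than 3, which cannot help here since 2 + 3 is not
  divisible by 3.\<close>

definition digit_3_cover :: "(nat \<times> nat \<times> nat) list" where
  "digit_3_cover = [(11, 2, 1), (73, 8, 4), (101, 4, 2), (137, 8, 0)]"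

text \<open>Divisors of 10^54 - 1; again 3 cannot help, since 2 + 9 is not divisible by 3.\<close>

definition digit_9_cover :: "(nat \<times> nat \<times> nat) list" where
  "digit_9_cover = [(7, 6, 5), (13, 6, 2), (19, 18, 3), (37, 3, 1), (757, 27, 9), (52579, 18, 12),
     (333667, 9, 6), (440334654777631, 27, 18), (70541929, 54, 0), (14175966169, 54, 27)]"

text \<open>As 10 is 1 modulo 3 and \<open>B_const\<close> is 2, the prime 3 alone handles every
  exponent for the digits 1 and 7.\<close>

definition digit_1_7_cover :: "(nat \<times> nat \<times> nat) list" where
  "digit_1_7_cover = [(3, 1, 0)]"

text \<open>The congruence makes b^n depend only on n modulo \<open>k\<close>, so one exponent
  \<open>e\<close> settles its class. The bound 10^15 makes every divisor proper later, and
  \<open>c\<close> is an integer to allow -1.\<close>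

fun cover_dvd :: "nat \<Rightarrow> int \<Rightarrow> nat \<times> nat \<times> nat \<Rightarrow> bool" where
  "cover_dvd b c (q, k, e) \<longleftrightarrow> 1 < q \<and> q < 10 ^ 15 \<and> q \<in> set covering_primes \<and>
     [b ^ k = 1] (mod q) \<and> int q dvd int (B_const mod q * b ^ e) + c"

lemma sierpinski_cover_dvd: "\<forall>t\<in>set sierpinski_cover. cover_dvd 2 1 t"
  by (simp add: sierpinski_cover_def covering_primes_def B_const_mod cong_def)

lemma riesel_cover_dvd: "\<forall>t\<in>set riesel_cover. cover_dvd 2 (-1) t"
  by (simp add: riesel_cover_def covering_primes_def B_const_mod cong_def)

lemma digit_cover_dvd:
  "\<forall>t\<in>set digit_1_7_cover. cover_dvd 10 1 t"
  "\<forall>t\<in>set digit_3_cover. cover_dvd 10 3 t"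
  "\<forall>t\<in>set digit_1_7_cover. cover_dvd 10 7 t"
  "\<forall>t\<in>set digit_9_cover. cover_dvd 10 9 t"
  by (simp_all add: digit_1_7_cover_def digit_3_cover_def digit_9_cover_def covering_primes_def B_const_mod cong_def)

text \<open>The factors multiply to the least common multiples 64, 1440, 1, 8 and 54 of the moduli.
  Growing the modulus stepwise discards most residues before the full modulus is reached.\<close>

lemma cover_covers:
  "covers sierpinski_cover [2, 2, 2, 2, 2, 2] 1 [0]"
  "covers riesel_cover [2, 3, 5, 2, 3, 2, 2, 2] 1 [0]"
  "covers digit_1_7_cover [] 1 [0]"
  "covers digit_3_cover [2, 2, 2] 1 [0]"
  "covers digit_9_cover [3, 2, 3, 3] 1 [0]"
  by (simp_all add: sierpinski_cover_def riesel_cover_def digit_1_7_cover_def digit_3_cover_def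
      digit_9_cover_def uncovered_def upt_rec)

section \<open>From the coverings to composite numbers\<close>

lemma coprime_of_division: "n = q * c + r \<Longrightarrow> coprime n q \<longleftrightarrow> coprime r q" for n :: nat
  by (metis cong_imp_coprime cong_sym cong_def mod_mult_self4)

lemma coprime_B_const_A_const: "coprime B_const A_const"
  unfolding A_const_eq covering_primes_def
  by (simp only: prod_list.Cons prod_list.Nil coprime_mult_right_iff coprime_1_right
        B_const_divisions[THEN coprime_of_division])
     (simp add: coprime_iff_gcd_eq_1 gcd_non_0_nat)

lemma covering_primes_dvd:
  assumes "q \<in> set covering_primes"
  shows "q dvd A_const"
proof -
  have "q dvd prod_list qs" if "q \<in> set qs" for qs using that by (induction qs) auto
  thus ?thesis using assms by (simp add: A_const_eq)
qed

lemma cover_dvd_sound: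
  assumes C: "cover_dvd b c (q, k, e)" and n: "n mod k = e" and p: "[p = B_const] (mod A_const)"
  shows "int q dvd int (p * b ^ n) + c"
proof -
  have "n = k * (n div k) + e" using n by (metis mult_div_mod_eq)
  hence "[b ^ n = b ^ (k * (n div k) + e)] (mod q)" by (metis cong_refl)
  also have "b ^ (k * (n div k) + e) = (b ^ k) ^ (n div k) * b ^ e" by (simp add: power_add power_mult)
  also have "[(b ^ k) ^ (n div k) * b ^ e = 1 ^ (n div k) * b ^ e] (mod q)"
    using C by (intro cong_mult cong_pow cong_refl) simp
  finally have "[b ^ n = b ^ e] (mod q)" by simp
  moreover have "[p = B_const mod q] (mod q)"
    using cong_dvd_modulus_nat[OF p covering_primes_dvd[of q]] C by (simp add: cong_def)
  ultimately have "[p * b ^ n = B_const mod q * b ^ e] (mod q)" by (rule cong_mult[rotated])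
  hence "[int (p * b ^ n) + c = int (B_const mod q * b ^ e) + c] (mod int q)"
    by (intro cong_add cong_refl) (simp only: cong_int_iff)
  thus ?thesis using C by (simp add: cong_dvd_iff)
qed

lemma composite_of_dvd: "q dvd n \<Longrightarrow> 1 < q \<Longrightarrow> q < n \<Longrightarrow> composite n"
  by (auto simp: composite_def prime_nat_iff)

lemma progression_ge:
  assumes "[p = B_const] (mod A_const)"
  shows "B_const \<le> p"
proof -
  \<comment> \<open>\<open>B_const < A_const\<close>, so \<open>B_const\<close> is the least element
    of its class.\<close>
  have "p mod A_const = B_const" using assms by (simp add: cong_def A_const_def B_const_def)
  thus ?thesis using mod_less_eq_dividend[of p A_const] by simp
qed

text \<open>The covering supplies a divisor below 10^15, and it is proper because \<open>p\<close>
  is at least \<open>B_const\<close>, which is far larger.\<close>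

lemma composite_of_cover:
  fixes x p :: nat
  assumes cov: "covers C fs 1 [0]" "\<forall>f\<in>set fs. f > 0" and C: "\<forall>t\<in>set C. cover_dvd b c t"
    and p: "[p = B_const] (mod A_const)"
    and x: "int x = int (p * b ^ n) + c" and c: "c \<ge> -1" and b: "b > 0"
  shows "composite x"
proof -
  obtain q k e where t: "(q, k, e) \<in> set C" "n mod k = e"
    using covers_sound[OF cov(1) _ cov(2), of n] by auto
  have t': "cover_dvd b c (q, k, e)" using C t by blast
  have "int q dvd int x" unfolding x by (rule cover_dvd_sound[OF t' t(2) p])
  hence "q dvd x" by simp
  moreover have "1 < q" "q < 10 ^ 15" using t' by auto
  moreover have "10 ^ 15 < x"
  proof -
    \<comment> \<open>The extra 1 absorbs \<open>c = -1\<close>.\<close>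
    have "10 ^ 15 + 1 < p" using progression_ge[OF p] by (simp add: B_const_def)
    moreover have "p * 1 \<le> p * b ^ n" using b by (intro mult_left_mono) auto
    ultimately have "10 ^ 15 + 1 < p * b ^ n" by linarith
    thus ?thesis using x c by linarith
  qed
  ultimately show ?thesis by (intro composite_of_dvd[of q]) auto
qed

lemma brier_number_progression:
  assumes p: "[p = B_const] (mod A_const)" and "odd p"
  shows "brier_number p"
proof -
  have "composite (p * 2 ^ n + 1)" for n
    by (rule composite_of_cover[OF cover_covers(1) _ sierpinski_cover_dvd p]) auto
  moreover have "composite (p * 2 ^ n - 1)" for n
  proof (rule composite_of_cover[OF cover_covers(2) _ riesel_cover_dvd p])
    have "1 \<le> p * 2 ^ n" using \<open>odd p\<close> by (simp add: Suc_le_eq odd_pos)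
    thus "int (p * 2 ^ n - 1) = int (p * 2 ^ n) + - 1" by (simp add: of_nat_diff)
  qed auto
  ultimately show ?thesis
    using \<open>odd p\<close> by (simp add: brier_number_def sierpinski_number_def riesel_number_def odd_pos)
qed

text \<open>Even digits and 5 are immediate, so 1, 3, 7 and 9 remain. For \<open>d = 0\<close> the
  last digit of \<open>p\<close> is replaced instead of a new one being appended, so the coverings
  do not apply; since that digit is 3, only 1, 7 and 9 have to be checked.\<close>

lemma all_translated_unit_sensitive_progression:
  assumes p: "[p = B_const] (mod A_const)"
  shows "all_translated_unit_sensitive p"
  unfolding all_translated_unit_sensitive_def
proof
  fix d
  have big: "p \<ge> 100" using progression_ge[OF p] by (simp add: B_const_def)
  have even: "composite (10 * x + j)" if "x \<ge> 10" "even j" for x j :: nat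
    using that by (intro composite_of_dvd[of 2]) auto
  have five: "composite (10 * x + 5)" if "x \<ge> 10" for x :: nat
    using that by (intro composite_of_dvd[of 5]) (auto intro: dvd_add)
  have digits: "j \<in> {1, 3, 5, 7, 9} \<or> even j" if "j \<in> {0..9}" for j :: nat
  proof -
    from that have "j \<le> 9" by simp
    thus ?thesis by (simp, presburger)
  qed
  show "translated_unit_sensitive d p"
  proof (cases "d = 0")
    case True
    define x where "x = p div 10"
    have mod_p: "p mod q = B_const mod q" if "q dvd A_const" for q
      using cong_dvd_modulus_nat[OF p that] by (simp add: cong_def)
    have "10 dvd A_const" by (simp add: A_const_eq covering_primes_def)
    moreover have "B_const mod 10 = 3" by (simp add: B_const_def)
    \<comment> \<open>The numbers in question are p - 2 and p + 4, divisible by 3, and p + 6,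
      divisible by 7.\<close>
    ultimately have "p mod 10 = 3" "p mod 3 = 2" "p mod 7 = 1"
      using mod_p covering_primes_dvd[of 3] covering_primes_dvd[of 7]
      by (simp_all add: B_const_mod covering_primes_def)
    then obtain u v where p10: "p = 10 * x + 3" and p3: "p = 3 * u + 2" and p7: "p = 7 * v + 1"
      unfolding x_def by (metis mult_div_mod_eq)
    have "10 * x + 1 = 3 * u" using p10 p3 by linarith
    moreover have "10 * x + 7 = 3 * (u + 2)" using p10 p3 by presburger
    moreover have "10 * x + 9 = 7 * (v + 1)" using p10 p7 by presburger
    ultimately have dvd: "3 dvd 10 * x + 1" "3 dvd 10 * x + 7" "7 dvd 10 * x + 9"
      by (metis dvd_triv_left)+
    have x: "x \<ge> 10" using big p10 by linarith
    have "composite (10 * x + 1)" "composite (10 * x + 7)" "composite (10 * x + 9)"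
      using dvd x by (auto intro: composite_of_dvd)
    hence "composite (10 * x + j)" if "j \<in> {0..9}" "j \<noteq> 3" for j
      using digits[OF that(1)] that(2) even[OF x] five[OF x] by blast
    hence "\<forall>j\<in>{0..9}. 10 * x + j \<noteq> p \<longrightarrow> composite (10 * x + j)" unfolding p10 by auto
    thus ?thesis using True big by (simp add: translated_unit_sensitive_def x_def)
  next
    case False
    then obtain d' where d: "d = Suc d'" by (cases d) auto
    define x where "x = 10 ^ d' * p"
    have "p \<le> x" by (simp add: x_def)
    hence x: "x \<ge> 10" using big by linarith
    have px: "10 ^ d * p + j = 10 * x + j" for j by (simp add: d x_def)
    have "composite (10 ^ d * p + 1)"
      by (rule composite_of_cover[OF cover_covers(3) _ digit_cover_dvd(1) p]) (auto simp: mult.commute)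
    moreover have "composite (10 ^ d * p + 3)"
      by (rule composite_of_cover[OF cover_covers(4) _ digit_cover_dvd(2) p]) (auto simp: mult.commute)
    moreover have "composite (10 ^ d * p + 7)"
      by (rule composite_of_cover[OF cover_covers(3) _ digit_cover_dvd(3) p]) (auto simp: mult.commute)
    moreover have "composite (10 ^ d * p + 9)"
      by (rule composite_of_cover[OF cover_covers(5) _ digit_cover_dvd(4) p]) (auto simp: mult.commute)
    moreover have "composite (10 ^ d * p + 5)" using five[OF x] px by simp
    moreover have "composite (10 ^ d * p + j)" if "even j" for j using even[OF x that] px by simp
    ultimately have "composite (10 ^ d * p + j)" if "j \<in> {0..9}" for j
      using digits[OF that] by blast
    thus ?thesis using False big by (simp add: translated_unit_sensitive_def)
  qed
qed

theorem theorem2: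
  shows "infinite {p :: nat. prime p \<and> all_translated_unit_sensitive p \<and> brier_number p}
    \<and> infinite {p :: nat. prime p \<and> (\<exists>m :: nat. p = A_const * m + B_const)
                  \<and> all_translated_unit_sensitive p \<and> brier_number p}"
proof -
  have "A_const > 1" by (simp add: A_const_def)
  hence inf: "infinite {p. prime p \<and> [p = B_const] (mod A_const)}"
    by (rule infinite_primes_cong) (rule coprime_B_const_A_const)
  have sub: "{p. prime p \<and> [p = B_const] (mod A_const)} \<subseteq> {p. prime p \<and>
    (\<exists>m. p = A_const * m + B_const) \<and> all_translated_unit_sensitive p \<and> brier_number p}"
  proof safe
    fix p assume "prime p" and p: "[p = B_const] (mod A_const)"
    note ge = progression_ge[OF p]
    have "2 < p" using ge by (simp add: B_const_def)
    hence "odd p" using \<open>prime p\<close> prime_odd_nat by blast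
    thus "brier_number p" by (rule brier_number_progression[OF p])
    show "all_translated_unit_sensitive p" by (rule all_translated_unit_sensitive_progression[OF p])
    obtain m where "p = m * A_const + B_const"
      using cong_le_nat[OF ge] p by blast
    thus "\<exists>m. p = A_const * m + B_const" by (metis mult.commute)
  qed
  have sub': "{p. prime p \<and> [p = B_const] (mod A_const)} \<subseteq>
      {p. prime p \<and> all_translated_unit_sensitive p \<and> brier_number p}"
    using sub by blast
  show ?thesis using infinite_super[OF sub' inf] infinite_super[OF sub inf] by blast
qed

end
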